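(* Let $\mathcal{N}_{uni}(z)$ be an LTI network over a field $\mathbb{F}$ with two transmitters $tx1,tx2$, relays $1,\dots,v$, and two receivers $rx1,rx2$, with channel matrices $H_{i,j}$. Let $d_{ax1},d_{ax2}$ be positive integers and let $K_{tx1}(z)\in\mathbb{F}(z)^{d_{tx1}\times d_{ax1}}$, $K_{tx2}(z)\in\mathbb{F}(z)^{d_{tx2}\times d_{ax2}}$, $K_i(z)\in\mathbb{F}(z)^{d_{i,in}\times d_{i,out}}$ ($1\le i\le v$), $K_{rx1}(z)\in\mathbb{F}(z)^{d_{ax1}\times d_{rx1}}$, $K_{rx2}(z)\in\mathbb{F}(z)^{d_{ax2}\times d_{rx2}}$. Assume that $$\begin{bmatrix}I-H_{1,1}K_1&\cdots&-H_{v,1}K_v\\ \vdots&\ddots&\vdots\\-H_{1,v}K_1&\cdots&I-H_{v,v}K_v\end{bmatrix}$$ (evaluated at $K_i=K_i(z)$) is invertible. Let $d=d_{rx1}+d_{rx2}+\sum_{i=1}^vd_{i,out}$. Then for all nonnegative integers $d_1,d_2,d_3,d_4$, the four conditions (i) $\operatorname{rank}K_{rx1}(z)G_{tx1,rx1}(z,K(z))K_{tx1}(z)\ge d_1$, (ii) $\operatorname{rank}K_{rx2}(z)G_{tx2,rx2}(z,K(z))K_{tx2}(z)\ge d_2$, (iii) $\operatorname{rank}K_{rx2}(z)G_{tx1,rx2}(z,K(z))K_{tx1}(z)\le d_3$, (iv) $\operatorname{rank}K_{rx1}(z)G_{tx2,rx1}(z,K(z))K_{tx2}(z)\le d_4$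 all hold if and only if the four conditions (a) $\operatorname{rank}G_{tx',rx11'}(z,K(z))\ge d+d_1$, (b) $\operatorname{rank}G_{tx',rx22'}(z,K(z))\ge d+d_2$, (c) $\operatorname{rank}G_{tx',rx12'}(z,K(z))\le d+d_3$, (d) $\operatorname{rank}G_{tx',rx21'}(z,K(z))\le d+d_4$ all hold.
   Context: $\mathbb{F}(z)$ is the field of rational functions in $z$ over $\mathbb{F}$. Transmitter $l$ has $d_{txl}$ channel inputs, receiver $k$ has $d_{rxk}$ channel outputs, relay $i$ has $d_{i,in}$ channel inputs and $d_{i,out}$ channel outputs. Channel matrices $H_{i,j}$ over $\mathbb{F}(z)$ from $i\in\{tx1,tx2,1,\dots,v\}$ to $j\in\{1,\dots,v,rx1,rx2\}$ are given (rows = outputs of $j$, columns = inputs of $i$). The transfer matrix from $txl$ to $rxk$ with relay gains $K_i$ is $$G_{txl,rxk}(z,K)=H_{txl,rxk}+\begin{bmatrix}H_{1,rxk}K_1&\cdots&H_{v,rxk}K_v\end{bmatrix}\left(I-\begin{bmatrix}H_{1,1}K_1&\cdots&H_{v,1}K_v\\ \vdots&\ddots&\vdots\\ H_{1,v}K_1&\cdots&H_{v,v}K_v\end{bmatrix}\right)^{-1}\begin{bmatrix}H_{txl,1}\\ \vdots\\ H_{txl,v}\end{bmatrix},$$ and $K(z)$ means that each gain matrix is replaced by the given matrix over $\mathbb{F}(z)$. Linearized matrices: blocks are of sizes $d_{ax1},d_{ax2},d_{rx1},d_{rx2},d_{1,out},\dots,d_{v,out}$ in this order. $A=\operatorname{diag}(0,0,I,I,I,\dots,I)$.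 For $l=1,2$, $B_{txl}=[0;0;H_{txl,rx1};H_{txl,rx2};H_{txl,1};\dots;H_{txl,v}]$; for $1\le i\le v$, $B_i=[0;0;H_{i,rx1};H_{i,rx2};H_{i,1};\dots;H_{i,v}]$; $B_{rx1}=[I;0;0;\dots;0]$, $B_{rx2}=[0;I;0;\dots;0]$ (block columns). $C_{tx1},C_{tx2},C_{rx1},C_{rx2},C_i$ are the block rows with $-I$ in the first, second, third, fourth, and $(4+i)$-th block respectively and zeros elsewhere. Define $$G_{tx',rx11'}=A+\sum_{i=1}^vB_iK_iC_i+B_{tx1}K_{tx1}C_{tx1}+B_{rx1}K_{rx1}C_{rx1},$$ $$G_{tx',rx22'}=A+\sum_{i=1}^vB_iK_iC_i+B_{tx2}K_{tx2}C_{tx2}+B_{rx2}K_{rx2}C_{rx2},$$ $$G_{tx',rx12'}=A+\sum_{i=1}^vB_iK_iC_i+B_{tx1}K_{tx1}C_{tx1}+B_{rx2}K_{rx2}C_{rx2},$$ $$G_{tx',rx21'}=A+\sum_{i=1}^vB_iK_iC_i+B_{tx2}K_{tx2}C_{tx2}+B_{rx1}K_{rx1}C_{rx1}.$$ All ranks are over $\mathbb{F}(z)$. *)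

theory Defs
  imports
    "HOL-Computational_Algebra.Fraction_Field"
    "HOL-Computational_Algebra.Polynomial"
    "Jordan_Normal_Form.Gauss_Jordan_Elimination"
    "Jordan_Normal_Form.DL_Rank"
begin

section \<open>Block matrices\<close>

text \<open>The field of rational functions in one variable over \<open>'a\<close> is \<open>'a poly fract\<close>.\<close>

text \<open>The number of rows of a block row (of columns of a block column) is a parameter, because
  it cannot be read off from an empty list of blocks.\<close>

definition block_row :: "nat \<Rightarrow> 'b::zero mat list \<Rightarrow> 'b mat" where
  "block_row nr Ms =
    foldr (\<lambda>A B. four_block_mat A B (0\<^sub>m 0 (dim_col A)) (0\<^sub>m 0 (dim_col B))) Ms (0\<^sub>m nr 0)"

definition block_col :: "nat \<Rightarrow> 'b::zero mat list \<Rightarrow> 'b mat" where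
  "block_col nc Ms = foldr (@\<^sub>r) Ms (0\<^sub>m 0 nc)"

text \<open>For a list of block sizes and a (zero-based) block index \<open>p\<close>: the block column with the
  identity in block \<open>p\<close>, and the block row with minus the identity in block \<open>p\<close>.\<close>

definition unit_block_col :: "nat list \<Rightarrow> nat \<Rightarrow> 'b::{zero,one} mat" where
  "unit_block_col ns p = block_col (ns ! p)
     (map (\<lambda>q. if q = p then 1\<^sub>m (ns ! p) else 0\<^sub>m (ns ! q) (ns ! p)) [0..<length ns])"

definition neg_unit_block_row :: "nat list \<Rightarrow> nat \<Rightarrow> 'b::ring_1 mat" where
  "neg_unit_block_row ns p = block_row (ns ! p)
     (map (\<lambda>q. if q = p then - 1\<^sub>m (ns ! p) else 0\<^sub>m (ns ! p) (ns ! q)) [0..<length ns])"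

definition mat_rank :: "'b::field mat \<Rightarrow> nat" where
  "mat_rank A = vec_space.rank (dim_row A) A"

section \<open>LTI networks with two transmitters and two receivers\<close>

datatype node = Tx1 | Tx2 | Relay nat | Rx1 | Rx2

text \<open>The relays are \<open>Relay 1, \<dots>, Relay (num_relays N)\<close>. Only the input dimensions of
  transmitters and relays and the output dimensions of relays and receivers are relevant;
  \<open>chan N i j\<close> is the channel matrix from \<open>i\<close> to \<open>j\<close>.\<close>

record (overloaded) ('a::field) network =
  num_relays :: nat
  d_in :: "node \<Rightarrow> nat"
  d_out :: "node \<Rightarrow> nat"
  chan :: "node \<Rightarrow> node \<Rightarrow> 'a poly fract mat"

definition relays :: "'a::field network \<Rightarrow> node list" where
  "relays N = map Relay [1..<Suc (num_relays N)]"

definition lti_network :: "'a::field network \<Rightarrow> bool" where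
  "lti_network N \<longleftrightarrow>
    (\<forall>i \<in> {Tx1, Tx2} \<union> set (relays N). \<forall>j \<in> set (relays N) \<union> {Rx1, Rx2}.
       chan N i j \<in> carrier_mat (d_out N j) (d_in N i))"

text \<open>In what follows, \<open>K\<close> assigns its gain matrix to every node. The block in row \<open>j\<close> and
  column \<open>i\<close> belongs to the channel from relay \<open>i\<close> to relay \<open>j\<close>.\<close>

definition relay_block_mat ::
  "'a::field network \<Rightarrow> (node \<Rightarrow> node \<Rightarrow> 'a poly fract mat) \<Rightarrow> 'a poly fract mat" where
  "relay_block_mat N F = block_col (\<Sum>i\<leftarrow>relays N. d_out N i)
     (map (\<lambda>j. block_row (d_out N j) (map (\<lambda>i. F j i) (relays N))) (relays N))"

definition loop_gain ::
  "'a::field network \<Rightarrow> (node \<Rightarrow> 'a poly fract mat) \<Rightarrow> 'a poly fract mat" where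
  "loop_gain N K = relay_block_mat N (\<lambda>j i. chan N i j * K i)"

text \<open>\<open>the (mat_inverse M)\<close> is the inverse of \<open>M\<close> whenever \<open>M\<close> is invertible, and unspecified
  otherwise.\<close>

definition transfer ::
  "'a::field network \<Rightarrow> (node \<Rightarrow> 'a poly fract mat) \<Rightarrow> node \<Rightarrow> node \<Rightarrow> 'a poly fract mat" where
  "transfer N K tx rx = chan N tx rx +
     block_row (d_out N rx) (map (\<lambda>i. chan N i rx * K i) (relays N))
     * the (mat_inverse (1\<^sub>m (\<Sum>i\<leftarrow>relays N. d_out N i) - loop_gain N K))
     * block_col (d_in N tx) (map (\<lambda>j. chan N tx j) (relays N))"

section \<open>Linearized transfer matrices\<close>

text \<open>The auxiliary dimensions of the two transmitter-receiver pairs are \<open>a1\<close> and \<open>a2\<close>.\<close>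

definition lin_sizes :: "'a::field network \<Rightarrow> nat \<Rightarrow> nat \<Rightarrow> nat list" where
  "lin_sizes N a1 a2 = [a1, a2, d_out N Rx1, d_out N Rx2] @ map (d_out N) (relays N)"

definition lin_A :: "'a::field network \<Rightarrow> nat \<Rightarrow> nat \<Rightarrow> 'a poly fract mat" where
  "lin_A N a1 a2 = diag_block_mat
     ([0\<^sub>m a1 a1, 0\<^sub>m a2 a2, 1\<^sub>m (d_out N Rx1), 1\<^sub>m (d_out N Rx2)]
      @ map (\<lambda>i. 1\<^sub>m (d_out N i)) (relays N))"

definition lin_B_chan :: "'a::field network \<Rightarrow> nat \<Rightarrow> nat \<Rightarrow> node \<Rightarrow> 'a poly fract mat" where
  "lin_B_chan N a1 a2 i = block_col (d_in N i)
     ([0\<^sub>m a1 (d_in N i), 0\<^sub>m a2 (d_in N i), chan N i Rx1, chan N i Rx2]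
      @ map (\<lambda>j. chan N i j) (relays N))"

fun lin_B :: "'a::field network \<Rightarrow> nat \<Rightarrow> nat \<Rightarrow> node \<Rightarrow> 'a poly fract mat" where
  "lin_B N a1 a2 Tx1 = lin_B_chan N a1 a2 Tx1"
| "lin_B N a1 a2 Tx2 = lin_B_chan N a1 a2 Tx2"
| "lin_B N a1 a2 (Relay i) = lin_B_chan N a1 a2 (Relay i)"
| "lin_B N a1 a2 Rx1 = unit_block_col (lin_sizes N a1 a2) 0"
| "lin_B N a1 a2 Rx2 = unit_block_col (lin_sizes N a1 a2) 1"

text \<open>Relays are numbered from 1 and blocks from 0, so relay \<open>i\<close> has block \<open>3 + i\<close>.\<close>

fun lin_C :: "'a::field network \<Rightarrow> nat \<Rightarrow> nat \<Rightarrow> node \<Rightarrow> 'a poly fract mat" where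
  "lin_C N a1 a2 Tx1 = neg_unit_block_row (lin_sizes N a1 a2) 0"
| "lin_C N a1 a2 Tx2 = neg_unit_block_row (lin_sizes N a1 a2) 1"
| "lin_C N a1 a2 Rx1 = neg_unit_block_row (lin_sizes N a1 a2) 2"
| "lin_C N a1 a2 Rx2 = neg_unit_block_row (lin_sizes N a1 a2) 3"
| "lin_C N a1 a2 (Relay i) = neg_unit_block_row (lin_sizes N a1 a2) (3 + i)"

text \<open>Since \<open>'a mat\<close> has no global zero, the sum over the relays is a fold starting with
  the matrix \<open>A\<close>.\<close>

definition lin_transfer ::
  "'a::field network \<Rightarrow> nat \<Rightarrow> nat \<Rightarrow> (node \<Rightarrow> 'a poly fract mat) \<Rightarrow> node \<Rightarrow> node
    \<Rightarrow> 'a poly fract mat" where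
  "lin_transfer N a1 a2 K tx rx =
     foldl (\<lambda>M i. M + lin_B N a1 a2 i * K i * lin_C N a1 a2 i) (lin_A N a1 a2) (relays N)
     + lin_B N a1 a2 tx * K tx * lin_C N a1 a2 tx
     + lin_B N a1 a2 rx * K rx * lin_C N a1 a2 rx"

end

theory Submission
  imports Defs
begin

text \<open>Order the blocks of a linearized transfer matrix so that the auxiliary dimensions come first.
  The lower right block \<open>T\<close> is then block triangular with diagonal blocks \<open>I\<close> and the given
  invertible matrix, so \<open>T\<close> is invertible of size \<open>d\<close>. The Schur complement of \<open>T\<close> is
  \<open>K_rx G_tx,rx K_tx\<close>, placed as one block of an otherwise zero matrix. Hence each linearized
  rank exceeds the corresponding rank \<open>rank (K_rx G_tx,rx K_tx)\<close> by exactly \<open>d\<close>, and the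
  conditions are equivalent one by one.\<close>

section \<open>Rank and one-sided inverses\<close>

text \<open>Rank is defined as the dimension of a column space, while the argument multiplies by
  matrices on both sides, some of them rectangular. Ranks are therefore certified by factorizations:
  if M = A B, where A has r columns and a left inverse and B has r rows and a right inverse, then M
  has rank r. Multiplying M by one-sided invertible matrices, or bordering it with an identity, only
  changes the one-sided inverses in such a certificate.

  The channel expression appears in the Schur complement because the inverse of T has top row
  [I, X (I - L)^(-1)], where X collects the gains from the relays to both receivers and L is the
  loop gain. Applied to the channels leaving a transmitter, this row gives the direct channel plus
  the relayed contribution, for both receivers at once; \<open>C_rx\<close> then selects one of
  them.

  Every linearized matrix carries the auxiliary rows and columns of both pairs but uses one
  transmitter and one receiver. So the complement is u (K_rx G K_tx) v, with u and v inserting a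
  block into the auxiliary coordinates. Since u has a left inverse and v a right inverse, the
  position of the block is irrelevant, and the direct and the cross pairs are treated alike.\<close>

lemma mat_mult_left_inv_cancel:
  fixes A :: "'b::semiring_1 mat"
  assumes "X \<in> carrier_mat r n" "A \<in> carrier_mat n r" "X * A = 1\<^sub>m r" "B \<in> carrier_mat r m"
  shows "X * (A * B) = B"
  using assoc_mult_mat[of X r n A r B m] assms by simp

text \<open>A left inverse makes \<open>A\<close> injective on vectors, so its columns are
  independent. The bound \<open>r \<le> n\<close> is what later limits the size of a
  compression.\<close>

lemma mat_rank_left_inverse:
  fixes A :: "'b::field mat"
  assumes A: "A \<in> carrier_mat n r" and X: "X \<in> carrier_mat r n" and XA: "X * A = 1\<^sub>m r"
  shows "mat_rank A = r" "r \<le> n"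
proof -
  interpret vec_space "TYPE('b)" n .
  have inj: "v = w" if "v \<in> carrier_vec r" "w \<in> carrier_vec r" "A *\<^sub>v v = A *\<^sub>v w" for v w
    by (metis that assoc_mult_mat_vec[OF X A] XA one_mult_mat_vec)
  \<comment> \<open>Independence is a property of the set of columns, in which repeated columns
    would collapse; distinctness has to be shown separately. Equal columns of \<open>A\<close> would
    give equal columns of \<open>X * A\<close>, that is, equal unit vectors.\<close>
  have dist: "distinct (cols A)"
  proof (rule ccontr)
    assume "\<not> distinct (cols A)"
    then obtain i j where ij: "i < r" "j < r" "i \<noteq> j" "col A i = col A j"
      using A by (auto simp: distinct_conv_nth)
    then have "col (X * A) i = col (X * A) j" using A X by (metis col_mult2)
    then have "unit_vec r i = (unit_vec r j :: 'b vec)" using ij by (simp add: XA)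
    with ij show False by (metis index_unit_vec(1) zero_neq_one)
  qed
  have indpt: "lin_indpt (set (cols A))"
  proof
    assume "lin_dep (set (cols A))"
    then obtain v where "v \<in> carrier_vec r" "v \<noteq> 0\<^sub>v r" "A *\<^sub>v v = 0\<^sub>v n"
      using lin_depE[OF A _ dist] by blast
    moreover have "A *\<^sub>v 0\<^sub>v r = 0\<^sub>v n" using A by auto
    ultimately show False using inj[of v "0\<^sub>v r"] by simp
  qed
  show "mat_rank A = r"
    using lin_indpt_full_rank[OF A dist indpt] A by (simp add: mat_rank_def)
  have "card (set (cols A)) \<le> dim"
    using li_le_dim(2)[OF fin_dim _ indpt] cols_dim[of A] A by simp
  then show "r \<le> n"
    using A distinct_card[OF dist] dim_is_n by simp
qed

text \<open>Since \<open>A = A * B * Y\<close>, the matrices \<open>A\<close> and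
  \<open>A * B\<close> have the same column space, so the rank is that of the left invertible
  factor.\<close>

lemma mat_rank_eqI:
  fixes A :: "'b::field mat"
  assumes A: "A \<in> carrier_mat nr r" and B: "B \<in> carrier_mat r nc"
    and X: "X \<in> carrier_mat r nr" and Y: "Y \<in> carrier_mat nc r"
    and XA: "X * A = 1\<^sub>m r" and BY: "B * Y = 1\<^sub>m r"
  shows "mat_rank (A * B) = r"
proof -
  interpret vec_space "TYPE('b)" nr .
  have AB: "A * B \<in> carrier_mat nr nc" using A B by simp
  have *: "A = A * B * Y" using assoc_mult_mat[OF A B Y] A BY by simp
  have "col_space (A * B) = col_space A"
  proof
    show "col_space (A * B) \<subseteq> col_space A"
    proof
      fix y assume "y \<in> col_space (A * B)"
      then obtain x where x: "x \<in> carrier_vec nc" "y = A * B *\<^sub>v x"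
        using A B unfolding col_space_eq[OF AB] by auto
      then have "y = A *\<^sub>v (B *\<^sub>v x)" using A B by simp
      then show "y \<in> col_space A" using A B x unfolding col_space_eq[OF A] by auto
    qed
    show "col_space A \<subseteq> col_space (A * B)"
    proof
      fix y assume "y \<in> col_space A"
      then obtain x where x: "x \<in> carrier_vec r" "y = A *\<^sub>v x"
        using A unfolding col_space_eq[OF A] by auto
      then have "y = A * B * Y *\<^sub>v x" using * by simp
      also have "\<dots> = A * B *\<^sub>v (Y *\<^sub>v x)" using AB Y x by simp
      finally show "y \<in> col_space (A * B)" using A B Y x unfolding col_space_eq[OF AB] by auto
    qed
  qed
  then have "mat_rank (A * B) = mat_rank A"
    using A by (simp add: mat_rank_def rank_def col_space_def)
  then show ?thesis using mat_rank_left_inverse[OF A X XA] by simp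
qed


section \<open>Existence of rank certificates\<close>

text \<open>One step of rank reduction. The residual \<open>D = M - M * Y * (X * M)\<close> is
  annihilated by \<open>X\<close> from the left and by \<open>Y\<close> from the right. A nonzero
  entry of \<open>D\<close> therefore supplies a new row and a new column that do not interact with
  the identity block already found.\<close>

lemma extend_identity_compression:
  fixes M :: "'b::field mat"
  assumes M: "M \<in> carrier_mat nr nc" and X: "X \<in> carrier_mat r nr" and Y: "Y \<in> carrier_mat nc r"
    and 1: "X * (M * Y) = 1\<^sub>m r" and neq: "M \<noteq> M * Y * (X * M)"
  shows "\<exists>X' Y'. X' \<in> carrier_mat (Suc r) nr \<and> Y' \<in> carrier_mat nc (Suc r) \<and>
    X' * (M * Y') = 1\<^sub>m (Suc r)"
proof -
  define D where "D = M - M * Y * (X * M)"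
  have D: "D \<in> carrier_mat nr nc" using M X Y unfolding D_def by auto
  have MY: "M * Y \<in> carrier_mat nr r" and XM: "X * M \<in> carrier_mat r nc" using M X Y by auto
  have XD: "X * D = 0\<^sub>m r nc"
  proof -
    have "X * D = X * M - X * (M * Y * (X * M))"
      unfolding D_def by (rule mult_minus_distrib_mat[OF X M mult_carrier_mat[OF MY XM]])
    also have "X * (M * Y * (X * M)) = X * (M * Y) * (X * M)"
      by (rule assoc_mult_mat[OF X MY XM, symmetric])
    finally show ?thesis using XM X by (simp add: 1)
  qed
  have XMY: "X * M * Y = 1\<^sub>m r" using 1 M X Y by simp
  have DY: "D * Y = 0\<^sub>m nr r"
  proof -
    have "D * Y = M * Y - M * Y * (X * M) * Y"
      unfolding D_def by (rule minus_mult_distrib_mat[OF M mult_carrier_mat[OF MY XM] Y])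
    also have "M * Y * (X * M) * Y = M * Y * (X * M * Y)"
      by (rule assoc_mult_mat[OF MY XM Y])
    finally show ?thesis unfolding XMY right_mult_one_mat[OF MY] minus_r_inv_mat[OF MY] .
  qed
  obtain i j where ij: "i < nr" "j < nc" "D $$ (i, j) \<noteq> 0"
  proof -
    have "D \<noteq> 0\<^sub>m nr nc"
    proof
      assume *: "D = 0\<^sub>m nr nc"
      have "M = D + M * Y * (X * M)"
        unfolding D_def using M MY XM by (intro eq_matI) (auto simp del: index_mult_mat(1))
      then have "M = M * Y * (X * M)"
        unfolding * left_add_zero_mat[OF mult_carrier_mat[OF MY XM]] .
      with neq show False ..
    qed
    then have "\<exists>i<nr. \<exists>j<nc. D $$ (i, j) \<noteq> 0" using D by (metis eq_matI carrier_matD index_zero_mat)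
    then show thesis using that by blast
  qed
  \<comment> \<open>\<open>e\<close> selects row \<open>i\<close>, and \<open>f\<close> selects
    column \<open>j\<close> scaled by the inverse of the chosen entry, so that
    \<open>e * (D * f)\<close> is the 1 by 1 identity.\<close>
  define e where "e = mat 1 nr (\<lambda>(_, k). if k = i then 1 else 0 :: 'b)"
  define f where "f = mat nc 1 (\<lambda>(k, _). if k = j then 1 / D $$ (i, j) else 0)"
  have e: "e \<in> carrier_mat 1 nr" and f: "f \<in> carrier_mat nc 1" unfolding e_def f_def by auto
  have eDf: "e * (D * f) = 1\<^sub>m 1"
  proof (rule eq_matI)
    fix a b assume "a < dim_row (1\<^sub>m 1 :: 'b mat)" "b < dim_col (1\<^sub>m 1 :: 'b mat)"
    then have [simp]: "a = 0" "b = 0" by auto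
    have "(D * f) $$ (i, 0) = (\<Sum>k = 0..<nc. D $$ (i, k) * (if k = j then 1 / D $$ (i, j) else 0))"
      using D ij f unfolding f_def by (simp add: scalar_prod_def)
    also have "\<dots> = (\<Sum>k = 0..<nc. if k = j then 1 else 0)"
      by (rule sum.cong) (use ij in auto)
    finally have 2: "(D * f) $$ (i, 0) = 1" using ij by simp
    have "(e * g) $$ (0, 0) = g $$ (i, 0)" if g: "g \<in> carrier_mat nr 1" for g
    proof -
      have "(e * g) $$ (0, 0) = (\<Sum>k = 0..<nr. (if k = i then 1 else 0) * g $$ (k, 0))"
        using g unfolding e_def by (simp add: scalar_prod_def)
      also have "\<dots> = (\<Sum>k = 0..<nr. if k = i then g $$ (i, 0) else 0)"
        by (rule sum.cong) auto
      finally show ?thesis using ij by simp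
    qed
    from this[OF mult_carrier_mat[OF D f]]
    have "(e * (D * f)) $$ (0, 0) = (D * f) $$ (i, 0)" .
    then show "(e * (D * f)) $$ (a, b) = 1\<^sub>m 1 $$ (a, b)" using 2 ij by simp
  qed (use e f in auto)
  \<comment> \<open>The corrections remove from \<open>e\<close> and \<open>f\<close> what
    \<open>X\<close> and \<open>Y\<close> already capture. They are chosen so that
    \<open>x * M = e * D\<close> and \<open>M * y = D * f\<close>; the mixed products then vanish
    because \<open>X * D\<close> and \<open>D * Y\<close> do.\<close>
  define x where "x = e - e * (M * Y * X)"
  define y where "y = f - Y * (X * M) * f"
  have x: "x \<in> carrier_mat 1 nr" and y: "y \<in> carrier_mat nc 1"
    using e f M X Y unfolding x_def y_def by auto
  have xM: "x * M = e * D"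
  proof -
    have MYX: "M * Y * X \<in> carrier_mat nr nr" using MY X by auto
    have "x * M = e * M - e * (M * Y * X) * M"
      unfolding x_def by (rule minus_mult_distrib_mat[OF e mult_carrier_mat[OF e MYX] M])
    also have "e * (M * Y * X) * M = e * (M * Y * X * M)" by (rule assoc_mult_mat[OF e MYX M])
    also have "M * Y * X * M = M * Y * (X * M)" by (rule assoc_mult_mat[OF MY X M])
    also have "e * M - e * (M * Y * (X * M)) = e * D"
      unfolding D_def by (rule mult_minus_distrib_mat[OF e M mult_carrier_mat[OF MY XM], symmetric])
    finally show ?thesis .
  qed
  have My: "M * y = D * f"
  proof -
    have YXM: "Y * (X * M) \<in> carrier_mat nc nc" using Y XM by auto
    have "M * y = M * f - M * (Y * (X * M) * f)"
      unfolding y_def by (rule mult_minus_distrib_mat[OF M f mult_carrier_mat[OF YXM f]])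
    also have "M * (Y * (X * M) * f) = M * (Y * (X * M)) * f" by (rule assoc_mult_mat[OF M YXM f, symmetric])
    also have "M * (Y * (X * M)) = M * Y * (X * M)" by (rule assoc_mult_mat[OF M Y XM, symmetric])
    also have "M * f - M * Y * (X * M) * f = D * f"
      unfolding D_def by (rule minus_mult_distrib_mat[OF M mult_carrier_mat[OF MY XM] f, symmetric])
    finally show ?thesis .
  qed
  have "X * (M * y) = 0\<^sub>m r 1" 
    unfolding My assoc_mult_mat[OF X D f, symmetric] XD using f by simp
  moreover have "x * (M * Y) = 0\<^sub>m 1 r" 
    unfolding assoc_mult_mat[OF x M Y, symmetric] xM assoc_mult_mat[OF e D Y] DY using e by simp
  moreover have "x * (M * y) = 1\<^sub>m 1"
  proof -
    have YX: "Y * (X * M) * f \<in> carrier_mat nc 1" using Y XM f by auto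
    have "x * (M * y) = e * D * y" unfolding assoc_mult_mat[OF x M y, symmetric] xM ..
    also have "\<dots> = e * (D * y)" by (rule assoc_mult_mat[OF e D y])
    also have "D * y = D * f - D * (Y * (X * M) * f)"
      unfolding y_def by (rule mult_minus_distrib_mat[OF D f YX])
    also have "D * (Y * (X * M) * f) = D * (Y * ((X * M) * f))"
      using assoc_mult_mat[OF Y XM f] by simp
    also have "\<dots> = D * Y * (X * M * f)"
      by (rule assoc_mult_mat[OF D Y mult_carrier_mat[OF XM f], symmetric])
    also have "D * f - D * Y * (X * M * f) = D * f"
    proof -
      have "G - 0\<^sub>m nr 1 = G" if "G \<in> carrier_mat nr 1" for G :: "'b mat"
        using that by (intro eq_matI) auto
      then show ?thesis
        unfolding DY left_mult_zero_mat[OF mult_carrier_mat[OF XM f]] using mult_carrier_mat[OF D f] .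
    qed
    finally show ?thesis by (simp add: eDf)
  qed
  \<comment> \<open>The new column is placed beside \<open>Y\<close> and the new row below
    \<open>X\<close>. Concatenation is written as a four-block matrix with empty blocks so that
    \<open>mult_four_block_mat\<close> computes the products.\<close>
  moreover have "M * four_block_mat Y y (0\<^sub>m 0 r) (0\<^sub>m 0 1)
      = four_block_mat (M * Y) (M * y) (0\<^sub>m 0 r) (0\<^sub>m 0 1)"
  proof -
    have "four_block_mat M (0\<^sub>m nr 0) (0\<^sub>m 0 nc) (0\<^sub>m 0 0) = M"
      using M by (intro eq_matI) auto
    then show ?thesis
      using mult_four_block_mat[OF M zero_carrier_mat zero_carrier_mat zero_carrier_mat[of 0 0] Y y
          zero_carrier_mat zero_carrier_mat] M Y y
      by (simp add: left_add_zero_mat right_add_zero_mat)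
  qed
  moreover have "four_block_mat X (0\<^sub>m r 0) x (0\<^sub>m 1 0)
      * four_block_mat (M * Y) (M * y) (0\<^sub>m 0 r) (0\<^sub>m 0 1)
      = four_block_mat (X * (M * Y)) (X * (M * y)) (x * (M * Y)) (x * (M * y))"
    using mult_four_block_mat[OF X zero_carrier_mat[of r 0] x zero_carrier_mat[of 1 0] MY 
         mult_carrier_mat[OF M y] zero_carrier_mat zero_carrier_mat] M X Y x y MY
    by (simp add: left_add_zero_mat right_add_zero_mat)
  ultimately have "four_block_mat X (0\<^sub>m r 0) x (0\<^sub>m 1 0)
     * (M * four_block_mat Y y (0\<^sub>m 0 r) (0\<^sub>m 0 1)) = 1\<^sub>m (r + 1)"
    by (simp add: 1)
  then show ?thesis
    using four_block_carrier_mat[OF X, of "0\<^sub>m 1 0" 1 0] four_block_carrier_mat[OF Y, of "0\<^sub>m 0 1" 0 1] 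
    by (intro exI conjI) auto
qed


text \<open>A compression \<open>X M Y = I\<close> of maximal size cannot be extended, which forces \<open>M = (M Y) (X M)\<close>.\<close>

lemma full_rank_factorization:
  fixes M :: "'b::field mat"
  assumes M: "M \<in> carrier_mat nr nc"
  obtains r X Y where "X \<in> carrier_mat r nr" "Y \<in> carrier_mat nc r"
    "X * (M * Y) = 1\<^sub>m r" "M = M * Y * (X * M)"
proof -
  define P where "P r \<longleftrightarrow> (\<exists>X Y. X \<in> carrier_mat r nr \<and> Y \<in> carrier_mat nc r \<and> X * (M * Y) = 1\<^sub>m r)" for r
  have "P 0" unfolding P_def by (intro exI[of _ "0\<^sub>m 0 nr"] exI[of _ "0\<^sub>m nc 0"]) auto
  \<comment> \<open>\<open>X\<close> is a left inverse of \<open>M * Y\<close>, which has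
    \<open>nr\<close> rows and \<open>r\<close> columns. The bound ensures that
    \<open>Greatest P\<close> is attained.\<close>
  have bound: "r \<le> nr" if "P r" for r
    using that M mat_rank_left_inverse(2)[of _ nr r] unfolding P_def by (meson mult_carrier_mat)
  define r where "r = Greatest P"
  have "P r" unfolding r_def using GreatestI_nat[of P 0 nr] \<open>P 0\<close> bound by blast
  then obtain X Y where XY: "X \<in> carrier_mat r nr" "Y \<in> carrier_mat nc r" "X * (M * Y) = 1\<^sub>m r"
    unfolding P_def by blast
  have "\<not> P (Suc r)"
  proof
    assume "P (Suc r)"
    then have "Suc r \<le> r" unfolding r_def using Greatest_le_nat[of P "Suc r" nr] bound by (simp add: r_def)
    then show False by simp
  qed
  then have "M = M * Y * (X * M)"
    using extend_identity_compression[OF M XY] unfolding P_def by blast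
  with XY that show thesis by blast
qed

section \<open>Invariance of rank and the Schur complement\<close>

text \<open>The certificate of \<open>M\<close> is transported: if \<open>M = A * B\<close>, then
  \<open>U * A\<close> has left inverse \<open>X * U'\<close> and \<open>B * V\<close> has right
  inverse \<open>V' * Y\<close>. Rectangular \<open>U\<close> and \<open>V\<close> are allowed
  because the lemma serves both the block elimination and the insertion of a matrix into a larger
  zero matrix.\<close>

lemma mat_rank_sandwich:
  fixes M :: "'b::field mat"
  assumes M: "M \<in> carrier_mat nr nc"
    and U: "U \<in> carrier_mat m nr" "U' \<in> carrier_mat nr m" "U' * U = 1\<^sub>m nr"
    and V: "V \<in> carrier_mat nc k" "V' \<in> carrier_mat k nc" "V * V' = 1\<^sub>m nc"
  shows "mat_rank (U * M * V) = mat_rank M"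
proof -
  obtain r X Y where XY: "X \<in> carrier_mat r nr" "Y \<in> carrier_mat nc r"
    "X * (M * Y) = 1\<^sub>m r" "M = M * Y * (X * M)"
    using full_rank_factorization[OF M] .
  define A where "A = M * Y"
  define B where "B = X * M"
  have A: "A \<in> carrier_mat nr r" and B: "B \<in> carrier_mat r nc"
    and XA: "X * A = 1\<^sub>m r" and BY: "B * Y = 1\<^sub>m r" and MAB: "M = A * B"
    using XY M unfolding A_def B_def by auto
  have "mat_rank (U * A * (B * V)) = r"
  proof (rule mat_rank_eqI)
    have "X * U' * (U * A) = X * (U' * (U * A))"
      by (rule assoc_mult_mat[OF XY(1) U(2) mult_carrier_mat[OF U(1) A]])
    also have "U' * (U * A) = A" by (rule mat_mult_left_inv_cancel[OF U(2,1,3) A])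
    finally show "X * U' * (U * A) = 1\<^sub>m r" by (simp add: XA)
    have "B * V * (V' * Y) = B * (V * (V' * Y))"
      by (rule assoc_mult_mat[OF B V(1) mult_carrier_mat[OF V(2) XY(2)]])
    also have "V * (V' * Y) = Y" by (rule mat_mult_left_inv_cancel[OF V XY(2)])
    finally show "B * V * (V' * Y) = 1\<^sub>m r" by (simp add: BY)
  qed (use A B U V XY in auto)
  moreover have "U * A * (B * V) = U * M * V" 
    unfolding MAB assoc_mult_mat[OF U(1) A B, symmetric]
    by (rule assoc_mult_mat[OF mult_carrier_mat[OF U(1) A] B V(1), symmetric])
  moreover have "mat_rank M = r" unfolding MAB by (rule mat_rank_eqI[OF A B XY(1,2) XA BY])
  ultimately show ?thesis by simp
qed

lemma mat_rank_diag_one: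
  fixes S :: "'b::field mat"
  assumes S: "S \<in> carrier_mat nr nc"
  shows "mat_rank (four_block_mat S (0\<^sub>m nr n) (0\<^sub>m n nc) (1\<^sub>m n)) = mat_rank S + n"
proof -
  obtain r X Y where XY: "X \<in> carrier_mat r nr" "Y \<in> carrier_mat nc r"
    "X * (S * Y) = 1\<^sub>m r" "S = S * Y * (X * S)"
    using full_rank_factorization[OF S] .
  define A where "A = S * Y"
  define B where "B = X * S"
  have A: "A \<in> carrier_mat nr r" and B: "B \<in> carrier_mat r nc"
    and XA: "X * A = 1\<^sub>m r" and BY: "B * Y = 1\<^sub>m r" and SAB: "S = A * B"
    using XY S unfolding A_def B_def by auto
  \<comment> \<open>Bordering by an identity is multiplicative, so it carries a factorization of
    \<open>S\<close> and its one-sided inverses to those of the bordered matrix.\<close>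
  let ?D = "\<lambda>M. four_block_mat M (0\<^sub>m (dim_row M) n) (0\<^sub>m n (dim_col M)) (1\<^sub>m n)"
  have D: "?D M * ?D M' = ?D (M * M')" if "dim_col M = dim_row M'" for M M' :: "'b mat"
    using that by (subst mult_four_block_mat[of _ "dim_row M" "dim_col M" _ n _ n _ _ "dim_col M'" _ n]) auto
  have "mat_rank (?D A * ?D B) = r + n"
  proof (rule mat_rank_eqI)
    show "?D X * ?D A = 1\<^sub>m (r + n)" using D[of X A] XA A XY by simp
    show "?D B * ?D Y = 1\<^sub>m (r + n)" using D[of B Y] BY B XY by simp
  qed (use A B XY in auto)
  moreover have "?D A * ?D B = ?D S" using D[of A B] A B SAB by simp
  moreover have "mat_rank S = r" unfolding SAB by (rule mat_rank_eqI[OF A B XY(1,2) XA BY])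
  ultimately show ?thesis using S by simp
qed

lemma mat_minus_plus_cancel:
  fixes A :: "'b::group_add mat"
  assumes "A \<in> carrier_mat nr nc" "B \<in> carrier_mat nr nc"
  shows "A - B + B = A"
  using assms by (intro eq_matI) auto

lemma mat_plus_uminus:
  fixes A :: "'b::group_add mat"
  assumes "A \<in> carrier_mat nr nc"
  shows "A + - A = 0\<^sub>m nr nc"
  using assms by (intro eq_matI) auto

text \<open>Block elimination, with \<open>T\<close> absorbed into the left factor
  \<open>?U\<close>. The middle factor is then the Schur complement bordered by an identity instead
  of by \<open>T\<close>, which is the form of \<open>mat_rank_diag_one\<close>.\<close>

lemma mat_rank_schur_complement:
  fixes Z :: "'b::field mat"
  assumes Z: "Z \<in> carrier_mat nr nc" and E: "E \<in> carrier_mat nr n"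
    and F: "F \<in> carrier_mat n nc" and T: "T \<in> carrier_mat n n"
    and R: "R \<in> carrier_mat n n" and TR: "T * R = 1\<^sub>m n"
  shows "mat_rank (four_block_mat Z E F T) = n + mat_rank (Z - E * (R * F))"
proof -
  define S where "S = Z - E * (R * F)"
  have S: "S \<in> carrier_mat nr nc" using Z E R F unfolding S_def by (simp add: minus_carrier_mat)
  have RT: "R * T = 1\<^sub>m n" by (rule mat_mult_left_right_inverse[OF T R TR])
  have RF: "R * F \<in> carrier_mat n nc" and ERF: "E * (R * F) \<in> carrier_mat nr nc"
    and ER: "E * R \<in> carrier_mat nr n" using E R F by auto
  have ERT: "E * R * T = E" using E R T RT by simp
  have TRF: "T * (R * F) = F" by (rule mat_mult_left_inv_cancel[OF T R TR F])
  let ?U = "four_block_mat (1\<^sub>m nr) E (0\<^sub>m n nr) T"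
  let ?U' = "four_block_mat (1\<^sub>m nr) (- (E * R)) (0\<^sub>m n nr) R"
  let ?V = "four_block_mat (1\<^sub>m nc) (0\<^sub>m nc n) (R * F) (1\<^sub>m n)"
  let ?V' = "four_block_mat (1\<^sub>m nc) (0\<^sub>m nc n) (- (R * F)) (1\<^sub>m n)"
  let ?D = "four_block_mat S (0\<^sub>m nr n) (0\<^sub>m n nc) (1\<^sub>m n)"
  have ZSE: "S + E * (R * F) = Z"
    unfolding S_def by (rule mat_minus_plus_cancel[OF Z ERF])
  have "?U * ?D = four_block_mat (1\<^sub>m nr * S + E * 0\<^sub>m n nc) (1\<^sub>m nr * 0\<^sub>m nr n + E * 1\<^sub>m n)
      (0\<^sub>m n nr * S + T * 0\<^sub>m n nc) (0\<^sub>m n nr * 0\<^sub>m nr n + T * 1\<^sub>m n)"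
    by (rule mult_four_block_mat) (use S E T in auto)
  also have "\<dots> = four_block_mat S E (0\<^sub>m n nc) T"
    using S E T by simp
  finally have UD: "?U * ?D = four_block_mat S E (0\<^sub>m n nc) T" .
  have "?U * ?D * ?V = four_block_mat (S * 1\<^sub>m nc + E * (R * F)) (S * 0\<^sub>m nc n + E * 1\<^sub>m n)
      (0\<^sub>m n nc * 1\<^sub>m nc + T * (R * F)) (0\<^sub>m n nc * 0\<^sub>m nc n + T * 1\<^sub>m n)"
    unfolding UD by (rule mult_four_block_mat) (use S E T RF in auto)
  also have "\<dots> = four_block_mat Z E F T"
    using S E T F by (simp add: ZSE TRF)
  finally have eq: "?U * ?D * ?V = four_block_mat Z E F T" .
  have "?U' * ?U = four_block_mat (1\<^sub>m nr * 1\<^sub>m nr + - (E * R) * 0\<^sub>m n nr) (1\<^sub>m nr * E + - (E * R) * T)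
      (0\<^sub>m n nr * 1\<^sub>m nr + R * 0\<^sub>m n nr) (0\<^sub>m n nr * E + R * T)"
    by (rule mult_four_block_mat) (use E R T ER in auto)
  also have "- (E * R) * T = - E"
    unfolding uminus_mult_left_mat[OF ER[THEN carrier_matD(2), THEN trans, OF T[THEN carrier_matD(1), symmetric]]] ERT ..
  also have "four_block_mat (1\<^sub>m nr * 1\<^sub>m nr + - (E * R) * 0\<^sub>m n nr) (1\<^sub>m nr * E + - E)
      (0\<^sub>m n nr * 1\<^sub>m nr + R * 0\<^sub>m n nr) (0\<^sub>m n nr * E + R * T) = 1\<^sub>m (nr + n)"
    using E R T ER by (simp add: RT right_mult_zero_mat[OF uminus_carrier_mat[OF ER]] mat_plus_uminus[OF E])
  finally have U: "?U' * ?U = 1\<^sub>m (nr + n)" .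
  have "?V * ?V' = four_block_mat (1\<^sub>m nc * 1\<^sub>m nc + 0\<^sub>m nc n * - (R * F)) (1\<^sub>m nc * 0\<^sub>m nc n + 0\<^sub>m nc n * 1\<^sub>m n)
      (R * F * 1\<^sub>m nc + 1\<^sub>m n * - (R * F)) (R * F * 0\<^sub>m nc n + 1\<^sub>m n * 1\<^sub>m n)"
    by (rule mult_four_block_mat) (use RF in auto)
  also have "\<dots> = 1\<^sub>m (nc + n)"
    by (simp add: left_mult_zero_mat[OF uminus_carrier_mat[OF RF]] right_mult_zero_mat[OF RF]
      right_mult_one_mat[OF RF] left_mult_one_mat[OF uminus_carrier_mat[OF RF]] mat_plus_uminus[OF RF] del: assoc_mult_mat)
  finally have V: "?V * ?V' = 1\<^sub>m (nc + n)" .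
  have "mat_rank (?U * ?D * ?V) = mat_rank ?D"
    by (rule mat_rank_sandwich[OF _ _ _ U _ _ V, where m = "nr + n" and k = "nc + n"])
      (use S E T R RF ER in auto)
  then show ?thesis unfolding eq mat_rank_diag_one[OF S] by (simp add: S_def)
qed

section \<open>Block rows and block columns\<close>

text \<open>The step folded in \<open>block_row\<close>, named as the horizontal counterpart of
  \<open>@\<^sub>r\<close> so that both kinds of block list can be treated by parallel
  inductions.\<close>

definition append_cols :: "'b::zero mat \<Rightarrow> 'b mat \<Rightarrow> 'b mat"  (infixr \<open>@\<^sub>c\<close> 65) where
  "A @\<^sub>c B = four_block_mat A B (0\<^sub>m 0 (dim_col A)) (0\<^sub>m 0 (dim_col B))"

lemma index_append_rows:
  "i < dim_row A + dim_row B \<Longrightarrow> j < dim_col A \<Longrightarrow>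
    (A @\<^sub>r B) $$ (i, j) = (if i < dim_row A then A $$ (i, j) else B $$ (i - dim_row A, j))"
  "dim_row (A @\<^sub>r B) = dim_row A + dim_row B"
  "dim_col (A @\<^sub>r B) = dim_col A"
  by (simp_all add: append_rows_def)

lemma index_append_cols:
  "i < dim_row A \<Longrightarrow> j < dim_col A + dim_col B \<Longrightarrow>
    (A @\<^sub>c B) $$ (i, j) = (if j < dim_col A then A $$ (i, j) else B $$ (i, j - dim_col A))"
  "dim_row (A @\<^sub>c B) = dim_row A"
  "dim_col (A @\<^sub>c B) = dim_col A + dim_col B"
  by (simp_all add: append_cols_def)

lemma carrier_append_cols [simp, intro]:
  "A \<in> carrier_mat nr nc1 \<Longrightarrow> B \<in> carrier_mat nr nc2 \<Longrightarrow> A @\<^sub>c B \<in> carrier_mat nr (nc1 + nc2)"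
  by (auto simp: index_append_cols)

lemmas index_append = index_append_rows index_append_cols

lemma append_rows_empty [simp]: "dim_col B = dim_col A \<Longrightarrow> dim_row B = 0 \<Longrightarrow> A @\<^sub>r B = A"
  by (intro eq_matI) (auto simp: index_append)

lemma append_cols_empty [simp]: "dim_col B = 0 \<Longrightarrow> A @\<^sub>c B = A"
  by (intro eq_matI) (auto simp: index_append)

lemma append_empty_cols [simp]: "0\<^sub>m (dim_row A) 0 @\<^sub>c A = A"
  by (intro eq_matI) (auto simp: index_append)

lemma append_rows_assoc:
  "dim_col B = dim_col A \<Longrightarrow> (A @\<^sub>r B) @\<^sub>r C = A @\<^sub>r B @\<^sub>r C"
  by (intro eq_matI) (auto simp: index_append)

lemma append_cols_assoc:
  "dim_row B = dim_row A \<Longrightarrow> (A @\<^sub>c B) @\<^sub>c C = A @\<^sub>c B @\<^sub>c C"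
  by (intro eq_matI) (auto simp: index_append)

lemma append_rows_zero: "0\<^sub>m m n @\<^sub>r 0\<^sub>m k n = 0\<^sub>m (m + k) n"
  by (intro eq_matI) (auto simp: index_append)

lemma append_cols_zero: "0\<^sub>m n m @\<^sub>c 0\<^sub>m n k = 0\<^sub>m n (m + k)"
  by (intro eq_matI) (auto simp: index_append)

text \<open>Together with the next lemma this is the interchange law of horizontal and vertical
  concatenation, with \<open>four_block_mat\<close> as the common value.\<close>

lemma append_rows_append_cols:
  assumes "A \<in> carrier_mat m p" "B \<in> carrier_mat m q" "C \<in> carrier_mat n p" "D \<in> carrier_mat n q"
  shows "(A @\<^sub>c B) @\<^sub>r (C @\<^sub>c D) = four_block_mat A B C D"
  using assms by (intro eq_matI) (auto simp: index_append)

lemma append_cols_append_rows: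
  assumes "A \<in> carrier_mat m p" "B \<in> carrier_mat m q" "C \<in> carrier_mat n p" "D \<in> carrier_mat n q"
  shows "(A @\<^sub>r C) @\<^sub>c (B @\<^sub>r D) = four_block_mat A B C D"
  using assms by (intro eq_matI) (auto simp: index_append)

lemma append_rows_mult:
  assumes "A \<in> carrier_mat m n" "B \<in> carrier_mat k n" "C \<in> carrier_mat n p"
  shows "(A @\<^sub>r B) * C = A * C @\<^sub>r B * C"
proof (rule eq_matI)
  fix i j assume "i < dim_row (A * C @\<^sub>r B * C)" "j < dim_col (A * C @\<^sub>r B * C)"
  moreover from this have "row (A @\<^sub>r B) i = (if i < m then row A i else row B (i - m))"
    using assms by (intro eq_vecI) (auto simp: index_append)
  ultimately show "((A @\<^sub>r B) * C) $$ (i, j) = (A * C @\<^sub>r B * C) $$ (i, j)"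
    using assms by (auto simp: index_append)
qed (auto simp: index_append)

lemma mult_append_cols:
  assumes "A \<in> carrier_mat m n" "B \<in> carrier_mat n p" "C \<in> carrier_mat n q"
  shows "A * (B @\<^sub>c C) = A * B @\<^sub>c A * C"
proof (rule eq_matI)
  fix i j assume "i < dim_row (A * B @\<^sub>c A * C)" "j < dim_col (A * B @\<^sub>c A * C)"
  moreover from this have "col (B @\<^sub>c C) j = (if j < p then col B j else col C (j - p))"
    using assms by (intro eq_vecI) (auto simp: index_append)
  ultimately show "(A * (B @\<^sub>c C)) $$ (i, j) = (A * B @\<^sub>c A * C) $$ (i, j)"
    using assms by (auto simp: index_append)
qed (auto simp: index_append)

lemma append_cols_mult_append_rows:
  fixes A :: "'b::semiring_0 mat"
  assumes "A \<in> carrier_mat m n" "B \<in> carrier_mat m k" "C \<in> carrier_mat n p" "D \<in> carrier_mat k p"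
  shows "(A @\<^sub>c B) * (C @\<^sub>r D) = A * C + B * D"
proof (rule eq_matI)
  fix i j assume ij: "i < dim_row (A * C + B * D)" "j < dim_col (A * C + B * D)"
  have "row (A @\<^sub>c B) i = row A i @\<^sub>v row B i" "col (C @\<^sub>r D) j = col C j @\<^sub>v col D j"
    using assms ij by (auto simp: index_append intro!: eq_vecI)
  then show "((A @\<^sub>c B) * (C @\<^sub>r D)) $$ (i, j) = (A * C + B * D) $$ (i, j)"
    using assms ij scalar_prod_append[of "row A i" n "row B i" k "col C j" "col D j"]
    by (auto simp: index_append)
qed (use assms in \<open>auto simp: index_append\<close>)

lemma append_rows_mult_append_cols:
  assumes A: "A \<in> carrier_mat m n" and B: "B \<in> carrier_mat k n"
    and C: "C \<in> carrier_mat n p" and D: "D \<in> carrier_mat n q"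
  shows "(A @\<^sub>r B) * (C @\<^sub>c D) = four_block_mat (A * C) (A * D) (B * C) (B * D)"
  unfolding append_rows_mult[OF A B carrier_append_cols[OF C D]] mult_append_cols[OF A C D]
    mult_append_cols[OF B C D]
  by (rule append_rows_append_cols) (use assms in auto)

lemma four_block_mult_append_rows:
  fixes A :: "'b::semiring_0 mat"
  assumes A: "A \<in> carrier_mat m n" and B: "B \<in> carrier_mat m k"
    and C: "C \<in> carrier_mat l n" and D: "D \<in> carrier_mat l k"
    and F: "F \<in> carrier_mat n p" and G: "G \<in> carrier_mat k p"
  shows "four_block_mat A B C D * (F @\<^sub>r G) = (A * F + B * G) @\<^sub>r (C * F + D * G)"
proof -
  have "four_block_mat A B C D = (A @\<^sub>c B) @\<^sub>r (C @\<^sub>c D)"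
    by (rule append_rows_append_cols[OF A B C D, symmetric])
  then show ?thesis
    using append_rows_mult[OF carrier_append_cols[OF A B] carrier_append_cols[OF C D] carrier_append_rows[OF F G]]
    by (simp add: append_cols_mult_append_rows[OF A B F G] append_cols_mult_append_rows[OF C D F G])
qed

lemma append_rows_add:
  fixes A :: "'b::monoid_add mat"
  assumes "A \<in> carrier_mat m n" "B \<in> carrier_mat k n" "C \<in> carrier_mat m n" "D \<in> carrier_mat k n"
  shows "(A @\<^sub>r B) + (C @\<^sub>r D) = (A + C) @\<^sub>r (B + D)"
  using assms by (intro eq_matI) (auto simp: index_append)

lemma append_rows_minus:
  fixes A :: "'b::group_add mat"
  assumes "A \<in> carrier_mat m n" "B \<in> carrier_mat k n" "C \<in> carrier_mat m n" "D \<in> carrier_mat k n"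
  shows "(A @\<^sub>r B) - (C @\<^sub>r D) = (A - C) @\<^sub>r (B - D)"
  using assms by (intro eq_matI) (auto simp: index_append)

lemma append_cols_add:
  fixes A :: "'b::monoid_add mat"
  assumes "A \<in> carrier_mat n m" "B \<in> carrier_mat n k" "C \<in> carrier_mat n m" "D \<in> carrier_mat n k"
  shows "(A @\<^sub>c B) + (C @\<^sub>c D) = (A + C) @\<^sub>c (B + D)"
  using assms by (intro eq_matI) (auto simp: index_append)

lemma append_cols_minus:
  fixes A :: "'b::group_add mat"
  assumes "A \<in> carrier_mat n m" "B \<in> carrier_mat n k" "C \<in> carrier_mat n m" "D \<in> carrier_mat n k"
  shows "(A @\<^sub>c B) - (C @\<^sub>c D) = (A - C) @\<^sub>c (B - D)"
  using assms by (intro eq_matI) (auto simp: index_append)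

lemma append_cols_uminus:
  fixes A :: "'b::group_add mat"
  assumes "A \<in> carrier_mat n m" "B \<in> carrier_mat n k"
  shows "- (A @\<^sub>c B) = - A @\<^sub>c - B"
  using assms by (intro eq_matI) (auto simp: index_append)

section \<open>Block rows and block columns given by lists\<close>

lemma block_row_Nil [simp]: "block_row nr [] = 0\<^sub>m nr 0"
  by (simp add: block_row_def)

lemma block_row_Cons [simp]: "block_row nr (A # As) = A @\<^sub>c block_row nr As"
  by (simp add: block_row_def append_cols_def)

lemma block_col_Nil [simp]: "block_col nc [] = 0\<^sub>m 0 nc"
  by (simp add: block_col_def)

lemma block_col_Cons [simp]: "block_col nc (A # As) = A @\<^sub>r block_col nc As"
  by (simp add: block_col_def)

lemma block_row_carrier:
  "(\<And>x. x \<in> set xs \<Longrightarrow> f x \<in> carrier_mat nr (c x)) \<Longrightarrow>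
    block_row nr (map f xs) \<in> carrier_mat nr (\<Sum>x\<leftarrow>xs. c x)"
  by (induction xs) auto

lemma block_col_carrier:
  "(\<And>x. x \<in> set xs \<Longrightarrow> f x \<in> carrier_mat (c x) nc) \<Longrightarrow>
    block_col nc (map f xs) \<in> carrier_mat (\<Sum>x\<leftarrow>xs. c x) nc"
  by (induction xs) auto

lemma block_row_append:
  assumes "\<And>A. A \<in> set As \<union> set Bs \<Longrightarrow> dim_row A = nr"
  shows "block_row nr (As @ Bs) = block_row nr As @\<^sub>c block_row nr Bs"
proof -
  have dim: "dim_row (block_row nr As) = nr" if "\<forall>A \<in> set As. dim_row A = nr" for As :: "'a mat list"
    using that by (induction As) (auto simp: index_append)
  show ?thesis
    using assms
  proof (induction As)
    case Nil
    then show ?case using append_empty_cols[of "block_row nr Bs"] dim[of Bs] by simp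
  next
    case (Cons A As)
    then show ?case using dim[of As] by (simp add: append_cols_assoc)
  qed
qed

lemma block_col_append:
  assumes "\<And>A. A \<in> set As \<union> set Bs \<Longrightarrow> dim_col A = nc"
  shows "block_col nc (As @ Bs) = block_col nc As @\<^sub>r block_col nc Bs"
proof -
  have dim: "dim_col (block_col nc As) = nc" if "\<forall>A \<in> set As. dim_col A = nc" for As :: "'a mat list"
    using that by (induction As) (auto simp: index_append)
  show ?thesis
    using assms
  proof (induction As)
    case Nil
    have "0\<^sub>m 0 nc @\<^sub>r block_col nc Bs = block_col nc Bs"
      using dim[of Bs] Nil by (intro eq_matI) (auto simp: index_append)
    then show ?case by simp
  next
    case (Cons A As)
    then show ?case using dim[of As] by (simp add: append_rows_assoc)
  qed
qed

lemma mult_block_row: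
  assumes M: "M \<in> carrier_mat m n" and f: "\<And>x. x \<in> set xs \<Longrightarrow> f x \<in> carrier_mat n (c x)"
  shows "M * block_row n (map f xs) = block_row m (map (\<lambda>x. M * f x) xs)"
  using f
proof (induction xs)
  case Nil
  then show ?case using M by simp
next
  case (Cons x xs)
  then show ?case
    using mult_append_cols[OF M, of "f x" "c x" "block_row n (map f xs)"] block_row_carrier[of xs f n c] by simp
qed

lemma block_col_mult:
  assumes M: "M \<in> carrier_mat n m" and f: "\<And>x. x \<in> set xs \<Longrightarrow> f x \<in> carrier_mat (c x) n"
  shows "block_col n (map f xs) * M = block_col m (map (\<lambda>x. f x * M) xs)"
  using f
proof (induction xs)
  case Nil
  then show ?case using M by simp
next
  case (Cons x xs)
  then show ?case
    using append_rows_mult[OF _ _ M, of "f x" "c x" "block_col n (map f xs)"] block_col_carrier[of xs f c n] by simp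
qed

lemma block_row_zero: "block_row nr (map (\<lambda>x. 0\<^sub>m nr (c x)) xs) = 0\<^sub>m nr (\<Sum>x\<leftarrow>xs. c x)"
  by (induction xs) (simp_all add: append_cols_zero)

lemma block_col_zero: "block_col nc (map (\<lambda>x. 0\<^sub>m (c x) nc) xs) = 0\<^sub>m (\<Sum>x\<leftarrow>xs. c x) nc"
  by (induction xs) (simp_all add: append_rows_zero)

lemma block_row_add:
  fixes f :: "'i \<Rightarrow> 'b::monoid_add mat"
  assumes "\<And>x. x \<in> set xs \<Longrightarrow> f x \<in> carrier_mat nr (c x)" "\<And>x. x \<in> set xs \<Longrightarrow> g x \<in> carrier_mat nr (c x)"
  shows "block_row nr (map f xs) + block_row nr (map g xs) = block_row nr (map (\<lambda>x. f x + g x) xs)"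
  using assms
proof (induction xs)
  case (Cons x xs)
  then show ?case
    using append_cols_add[of "f x" nr "c x" "block_row nr (map f xs)" _ "g x" "block_row nr (map g xs)"]
      block_row_carrier[of xs f nr c] block_row_carrier[of xs g nr c] by simp
qed simp

lemma block_row_minus:
  fixes f :: "'i \<Rightarrow> 'b::group_add mat"
  assumes "\<And>x. x \<in> set xs \<Longrightarrow> f x \<in> carrier_mat nr (c x)" "\<And>x. x \<in> set xs \<Longrightarrow> g x \<in> carrier_mat nr (c x)"
  shows "block_row nr (map f xs) - block_row nr (map g xs) = block_row nr (map (\<lambda>x. f x - g x) xs)"
  using assms
proof (induction xs)
  case (Cons x xs)
  then show ?case
    using append_cols_minus[of "f x" nr "c x" "block_row nr (map f xs)" _ "g x" "block_row nr (map g xs)"]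
      block_row_carrier[of xs f nr c] block_row_carrier[of xs g nr c] by simp
qed simp

lemma block_col_minus:
  fixes f :: "'i \<Rightarrow> 'b::group_add mat"
  assumes "\<And>x. x \<in> set xs \<Longrightarrow> f x \<in> carrier_mat (c x) nc" "\<And>x. x \<in> set xs \<Longrightarrow> g x \<in> carrier_mat (c x) nc"
  shows "block_col nc (map f xs) - block_col nc (map g xs) = block_col nc (map (\<lambda>x. f x - g x) xs)"
  using assms
proof (induction xs)
  case (Cons x xs)
  then show ?case
    using append_rows_minus[of "f x" "c x" nc "block_col nc (map f xs)" _ "g x" "block_col nc (map g xs)"]
      block_col_carrier[of xs f c nc] block_col_carrier[of xs g c nc] by simp
qed simp

lemma block_row_uminus:
  fixes f :: "'i \<Rightarrow> 'b::group_add mat"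
  assumes "\<And>x. x \<in> set xs \<Longrightarrow> f x \<in> carrier_mat nr (c x)"
  shows "block_row nr (map (\<lambda>x. - f x) xs) = - block_row nr (map f xs)"
  using assms
proof (induction xs)
  case Nil
  show ?case by (intro eq_matI) auto
next
  case (Cons x xs)
  then show ?case
    using append_cols_uminus[of "f x" nr "c x" "block_row nr (map f xs)"] block_row_carrier[of xs f nr c]
    by simp
qed

lemma block_row_append_rows:
  assumes "\<And>x. x \<in> set xs \<Longrightarrow> f x \<in> carrier_mat m (c x)" "\<And>x. x \<in> set xs \<Longrightarrow> g x \<in> carrier_mat n (c x)"
  shows "block_row (m + n) (map (\<lambda>x. f x @\<^sub>r g x) xs) = block_row m (map f xs) @\<^sub>r block_row n (map g xs)"
  using assms
proof (induction xs)
  case Nil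
  show ?case by (simp add: append_rows_zero)
next
  case (Cons x xs)
  let ?f = "block_row m (map f xs)" and ?g = "block_row n (map g xs)"
  have f: "f x \<in> carrier_mat m (c x)" "?f \<in> carrier_mat m (\<Sum>x\<leftarrow>xs. c x)"
    and g: "g x \<in> carrier_mat n (c x)" "?g \<in> carrier_mat n (\<Sum>x\<leftarrow>xs. c x)"
    using Cons.prems block_row_carrier[of xs f m c] block_row_carrier[of xs g n c] by auto
  show ?case
    using Cons append_cols_append_rows[OF f g] append_rows_append_cols[OF f g] by simp
qed

lemma block_col_append_cols:
  assumes "\<And>x. x \<in> set xs \<Longrightarrow> f x \<in> carrier_mat (c x) m" "\<And>x. x \<in> set xs \<Longrightarrow> g x \<in> carrier_mat (c x) n"
  shows "block_col (m + n) (map (\<lambda>x. f x @\<^sub>c g x) xs) = block_col m (map f xs) @\<^sub>c block_col n (map g xs)"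
  using assms
proof (induction xs)
  case Nil
  show ?case by (simp add: append_cols_zero)
next
  case (Cons x xs)
  let ?f = "block_col m (map f xs)" and ?g = "block_col n (map g xs)"
  have f: "f x \<in> carrier_mat (c x) m" "?f \<in> carrier_mat (\<Sum>x\<leftarrow>xs. c x) m"
    and g: "g x \<in> carrier_mat (c x) n" "?g \<in> carrier_mat (\<Sum>x\<leftarrow>xs. c x) n"
    using Cons.prems block_col_carrier[of xs f c m] block_col_carrier[of xs g c n] by auto
  show ?case
    using Cons append_cols_append_rows[OF f(1) g(1) f(2) g(2)] append_rows_append_cols[OF f(1) g(1) f(2) g(2)] by simp
qed

text \<open>Needed because the relay sum in a linearized matrix is built column by column, from the
  products of \<open>lin_B\<close> and the gains, whereas \<open>relay_block_mat\<close> is built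
  row by row.\<close>

lemma block_row_block_col:
  assumes "\<And>i j. i \<in> set xs \<Longrightarrow> j \<in> set ys \<Longrightarrow> F j i \<in> carrier_mat (r j) (c i)"
  shows "block_row (\<Sum>j\<leftarrow>ys. r j) (map (\<lambda>i. block_col (c i) (map (\<lambda>j. F j i) ys)) xs)
    = block_col (\<Sum>i\<leftarrow>xs. c i) (map (\<lambda>j. block_row (r j) (map (F j) xs)) ys)"
  using assms
proof (induction ys)
  case Nil
  show ?case by (simp add: block_row_zero)
next
  case (Cons y ys)
  have "block_row (r y + (\<Sum>j\<leftarrow>ys. r j)) (map (\<lambda>i. F y i @\<^sub>r block_col (c i) (map (\<lambda>j. F j i) ys)) xs)
    = block_row (r y) (map (F y) xs) @\<^sub>r block_row (\<Sum>j\<leftarrow>ys. r j) (map (\<lambda>i. block_col (c i) (map (\<lambda>j. F j i) ys)) xs)"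
    by (rule block_row_append_rows[where c = c]) (use Cons.prems in \<open>auto intro!: block_col_carrier\<close>)
  then show ?case using Cons by simp
qed

text \<open>Allows a subtraction from the identity to be done block by block. Diagonal blocks are
  recognized by comparing list entries, not positions, hence the distinctness.\<close>

lemma block_identity:
  fixes c :: "'i \<Rightarrow> nat"
  assumes "distinct xs"
  shows "block_col (\<Sum>x\<leftarrow>xs. c x)
    (map (\<lambda>j. block_row (c j) (map (\<lambda>i. if i = j then 1\<^sub>m (c j) else 0\<^sub>m (c j) (c i)) xs)) xs)
    = (1\<^sub>m (\<Sum>x\<leftarrow>xs. c x) :: 'b::{zero,one} mat)"
  using assms
proof (induction xs)
  case Nil
  show ?case by (intro eq_matI) auto
next
  case (Cons x xs)
  let ?F = "\<lambda>j i. if i = j then 1\<^sub>m (c j) else 0\<^sub>m (c j) (c i) :: 'b mat"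
  let ?s = "\<Sum>x\<leftarrow>xs. c x"
  have "block_row (c x) (map (?F x) xs) = block_row (c x) (map (\<lambda>i. 0\<^sub>m (c x) (c i)) xs)"
    using Cons.prems by (intro arg_cong[where f = "block_row (c x)"] map_cong) auto
  then have 1: "block_row (c x) (map (?F x) xs) = 0\<^sub>m (c x) ?s"
    by (simp add: block_row_zero)
  have "block_col (c x + ?s) (map (\<lambda>j. block_row (c j) (map (?F j) (x # xs))) xs)
    = block_col (c x + ?s) (map (\<lambda>j. 0\<^sub>m (c j) (c x) @\<^sub>c block_row (c j) (map (?F j) xs)) xs)"
    using Cons.prems by (intro arg_cong[where f = "block_col (c x + ?s)"] map_cong) auto
  also have "\<dots> = block_col (c x) (map (\<lambda>j. 0\<^sub>m (c j) (c x)) xs) @\<^sub>c block_col ?s (map (\<lambda>j. block_row (c j) (map (?F j) xs)) xs)"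
    by (rule block_col_append_cols[where c = c]) (auto intro!: block_row_carrier)
  also have "\<dots> = 0\<^sub>m ?s (c x) @\<^sub>c 1\<^sub>m ?s"
    using Cons by (simp add: block_col_zero)
  finally show ?case
    using append_rows_append_cols[of "1\<^sub>m (c x)" "c x" "c x" "0\<^sub>m (c x) ?s" ?s "0\<^sub>m ?s (c x)" ?s "1\<^sub>m ?s"] 1
    by simp
qed

section \<open>Unit block columns and negative unit block rows\<close>

lemma upt_length_append:
  "[0..<length (ms @ ns)] = [0..<length ms] @ map (\<lambda>q. length ms + q) [0..<length ns]"
  by (rule nth_equalityI) (auto simp: nth_append)

text \<open>This lemma and the next two split a list of sizes at a group boundary. They reduce the
  unit blocks of a network with any number of relays to those of a two-element list, padded with
  zeros.\<close>

lemma unit_block_col_append: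
  assumes p: "p < length ms"
  shows "(unit_block_col (ms @ ns) p :: 'b::{zero,one} mat) = unit_block_col ms p @\<^sub>r 0\<^sub>m (sum_list ns) (ms ! p)"
proof -
  let ?f = "\<lambda>ns q. if q = p then 1\<^sub>m (ms ! p) else 0\<^sub>m (ns ! q) (ms ! p) :: 'b mat"
  note split = upt_length_append[of ms ns]
  have nth: "(ms @ ns) ! p = ms ! p" using p by (simp add: nth_append)
  have l: "map (?f (ms @ ns)) [0..<length ms] = map (?f ms) [0..<length ms]"
    by (auto simp: nth_append)
  have r: "map (?f (ms @ ns)) (map (\<lambda>q. length ms + q) [0..<length ns])
      = map (\<lambda>q. 0\<^sub>m (ns ! q) (ms ! p)) [0..<length ns]"
    using p by auto
  have "unit_block_col (ms @ ns) p = block_col (ms ! p) (map (?f (ms @ ns)) [0..<length (ms @ ns)])"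
    unfolding unit_block_col_def nth ..
  also have "\<dots> = block_col (ms ! p) (map (?f ms) [0..<length ms])
      @\<^sub>r block_col (ms ! p) (map (\<lambda>q. 0\<^sub>m (ns ! q) (ms ! p)) [0..<length ns])"
    unfolding split map_append l r by (rule block_col_append) auto
  also have "block_col (ms ! p) (map (\<lambda>q. 0\<^sub>m (ns ! q) (ms ! p)) [0..<length ns])
      = (0\<^sub>m (sum_list ns) (ms ! p) :: 'b mat)"
    unfolding block_col_zero by (simp add: map_nth)
  finally show ?thesis by (simp add: unit_block_col_def)
qed

lemma neg_unit_block_row_append1:
  assumes p: "p < length ms"
  shows "(neg_unit_block_row (ms @ ns) p :: 'b::ring_1 mat) = neg_unit_block_row ms p @\<^sub>c 0\<^sub>m (ms ! p) (sum_list ns)"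
proof -
  let ?f = "\<lambda>ns q. if q = p then - 1\<^sub>m (ms ! p) else 0\<^sub>m (ms ! p) (ns ! q) :: 'b mat"
  note split = upt_length_append[of ms ns]
  have nth: "(ms @ ns) ! p = ms ! p" using p by (simp add: nth_append)
  have l: "map (?f (ms @ ns)) [0..<length ms] = map (?f ms) [0..<length ms]"
    by (auto simp: nth_append)
  have r: "map (?f (ms @ ns)) (map (\<lambda>q. length ms + q) [0..<length ns])
      = map (\<lambda>q. 0\<^sub>m (ms ! p) (ns ! q)) [0..<length ns]"
    using p by auto
  have "neg_unit_block_row (ms @ ns) p = block_row (ms ! p) (map (?f (ms @ ns)) [0..<length (ms @ ns)])"
    unfolding neg_unit_block_row_def nth ..
  also have "\<dots> = block_row (ms ! p) (map (?f ms) [0..<length ms])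
      @\<^sub>c block_row (ms ! p) (map (\<lambda>q. 0\<^sub>m (ms ! p) (ns ! q)) [0..<length ns])"
    unfolding split map_append l r by (rule block_row_append) auto
  also have "block_row (ms ! p) (map (\<lambda>q. 0\<^sub>m (ms ! p) (ns ! q)) [0..<length ns])
      = (0\<^sub>m (ms ! p) (sum_list ns) :: 'b mat)"
    unfolding block_row_zero by (simp add: map_nth)
  finally show ?thesis by (simp add: neg_unit_block_row_def)
qed

lemma neg_unit_block_row_append2:
  "(neg_unit_block_row (ms @ ns) (length ms + p) :: 'b::ring_1 mat)
    = 0\<^sub>m (ns ! p) (sum_list ms) @\<^sub>c neg_unit_block_row ns p"
proof -
  let ?f = "\<lambda>ns p q. if q = p then - 1\<^sub>m (ns ! p) else 0\<^sub>m (ns ! p) (ns ! q) :: 'b mat"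
  note split = upt_length_append[of ms ns]
  have l: "map (?f (ms @ ns) (length ms + p)) [0..<length ms] = map (\<lambda>q. 0\<^sub>m (ns ! p) (ms ! q)) [0..<length ms]"
    by (auto simp: nth_append)
  have r: "map (?f (ms @ ns) (length ms + p)) (map (\<lambda>q. length ms + q) [0..<length ns]) = map (?f ns p) [0..<length ns]"
    by auto
  have "neg_unit_block_row (ms @ ns) (length ms + p)
      = block_row (ns ! p) (map (?f (ms @ ns) (length ms + p)) [0..<length (ms @ ns)])"
    by (simp add: neg_unit_block_row_def)
  also have "\<dots> = block_row (ns ! p) (map (\<lambda>q. 0\<^sub>m (ns ! p) (ms ! q)) [0..<length ms])
      @\<^sub>c block_row (ns ! p) (map (?f ns p) [0..<length ns])"
    unfolding split map_append l r by (rule block_row_append) auto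
  also have "block_row (ns ! p) (map (\<lambda>q. 0\<^sub>m (ns ! p) (ms ! q)) [0..<length ms])
      = (0\<^sub>m (ns ! p) (sum_list ms) :: 'b mat)"
    unfolding block_row_zero by (simp add: map_nth)
  finally show ?thesis by (simp add: neg_unit_block_row_def)
qed

lemma unit_block_col_carrier:
  "(unit_block_col ns p :: 'b::{zero,one} mat) \<in> carrier_mat (sum_list ns) (ns ! p)"
proof -
  have "block_col (ns ! p) (map (\<lambda>q. if q = p then 1\<^sub>m (ns ! p) else 0\<^sub>m (ns ! q) (ns ! p) :: 'b mat)
      [0..<length ns]) \<in> carrier_mat (\<Sum>q\<leftarrow>[0..<length ns]. ns ! q) (ns ! p)"
    by (rule block_col_carrier) auto
  then show ?thesis by (simp add: unit_block_col_def map_nth)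
qed

lemma neg_unit_block_row_carrier:
  "(neg_unit_block_row ns p :: 'b::ring_1 mat) \<in> carrier_mat (ns ! p) (sum_list ns)"
proof -
  have "block_row (ns ! p) (map (\<lambda>q. if q = p then - 1\<^sub>m (ns ! p) else 0\<^sub>m (ns ! p) (ns ! q) :: 'b mat)
      [0..<length ns]) \<in> carrier_mat (ns ! p) (\<Sum>q\<leftarrow>[0..<length ns]. ns ! q)"
    by (rule block_row_carrier) auto
  then show ?thesis by (simp add: neg_unit_block_row_def map_nth)
qed

lemma mult_neg_unit_block_row:
  fixes Z :: "'b::ring_1 mat"
  assumes Z: "Z \<in> carrier_mat m (ns ! p)"
  shows "Z * neg_unit_block_row ns p
    = block_row m (map (\<lambda>q. if q = p then - Z else 0\<^sub>m m (ns ! q)) [0..<length ns])"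
proof -
  let ?f = "\<lambda>q. if q = p then - 1\<^sub>m (ns ! p) else 0\<^sub>m (ns ! p) (ns ! q) :: 'b mat"
  have "Z * neg_unit_block_row ns p = block_row m (map (\<lambda>q. Z * ?f q) [0..<length ns])"
    unfolding neg_unit_block_row_def by (rule mult_block_row[OF Z, where c = "(!) ns"]) auto
  also have "map (\<lambda>q. Z * ?f q) [0..<length ns] = map (\<lambda>q. if q = p then - Z else 0\<^sub>m m (ns ! q)) [0..<length ns]"
    using Z by auto
  finally show ?thesis .
qed

text \<open>Each summand is supported in its own block column, where it equals \<open>- Z q\<close>.
  The sum is thus a single block row, placed to the right of the columns belonging to
  \<open>ms\<close>.\<close>

lemma foldl_mult_neg_unit_block_row:
  fixes Z :: "nat \<Rightarrow> 'b::ring_1 mat"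
  assumes A: "A \<in> carrier_mat n (sum_list (ms @ ns))"
    and Z: "\<And>q. q < length ns \<Longrightarrow> Z q \<in> carrier_mat n (ns ! q)"
  shows "foldl (\<lambda>M q. M + Z q * neg_unit_block_row (ms @ ns) (length ms + q)) A [0..<length ns]
    = A + (0\<^sub>m n (sum_list ms) @\<^sub>c - block_row n (map Z [0..<length ns]))"
proof -
  \<comment> \<open>Invariant of the fold: after \<open>m\<close> summands the first
    \<open>m\<close> block columns are filled and the others are still zero.\<close>
  let ?g = "\<lambda>m q. if q < m then - Z q else 0\<^sub>m n (ns ! q)"
  let ?B = "\<lambda>m. 0\<^sub>m n (sum_list ms) @\<^sub>c block_row n (map (?g m) [0..<length ns])"
  have g: "?g m q \<in> carrier_mat n (ns ! q)" if "q \<in> set [0..<length ns]" for m q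
    using Z that by auto
  have s: "(\<Sum>q\<leftarrow>[0..<length ns]. ns ! q) = sum_list ns" by (simp add: map_nth)
  have G: "block_row n (map (?g m) [0..<length ns]) \<in> carrier_mat n (sum_list ns)" for m
    using block_row_carrier[of "[0..<length ns]" "?g m" n "(!) ns", OF g] unfolding s .
  have "foldl (\<lambda>M q. M + Z q * neg_unit_block_row (ms @ ns) (length ms + q)) A [0..<m] = A + ?B m"
    if "m \<le> length ns" for m
    using that
  proof (induction m)
    case 0
    have "block_row n (map (\<lambda>q. 0\<^sub>m n (ns ! q)) [0..<length ns]) = (0\<^sub>m n (sum_list ns) :: 'b mat)"
      unfolding block_row_zero s ..
    then show ?case using A by (simp add: append_cols_zero)
  next
    case (Suc m)
    let ?h = "\<lambda>q. if q = m then - Z m else 0\<^sub>m n (ns ! q)"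
    have Zm: "Z m \<in> carrier_mat n (ns ! m)" using Z Suc.prems by simp
    have h: "?h q \<in> carrier_mat n (ns ! q)" for q using Zm by auto
    have H: "block_row n (map ?h [0..<length ns]) \<in> carrier_mat n (sum_list ns)"
      using block_row_carrier[of "[0..<length ns]" ?h n "(!) ns", OF h] unfolding s .
    have "Z m * neg_unit_block_row (ms @ ns) (length ms + m)
      = 0\<^sub>m n (sum_list ms) @\<^sub>c block_row n (map ?h [0..<length ns])"
      unfolding neg_unit_block_row_append2
        mult_append_cols[OF Zm zero_carrier_mat neg_unit_block_row_carrier] mult_neg_unit_block_row[OF Zm]
      using Zm by simp
    moreover have "?B m + (0\<^sub>m n (sum_list ms) @\<^sub>c block_row n (map ?h [0..<length ns])) = ?B (Suc m)"
    proof -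
      have "block_row n (map (?g m) [0..<length ns]) + block_row n (map ?h [0..<length ns])
        = block_row n (map (\<lambda>q. ?g m q + ?h q) [0..<length ns])"
        by (rule block_row_add[OF g h])
      also have "map (\<lambda>q. ?g m q + ?h q) [0..<length ns] = map (?g (Suc m)) [0..<length ns]"
        using Z Zm by (auto simp: less_Suc_eq left_add_zero_mat right_add_zero_mat)
      finally show ?thesis
        unfolding append_cols_add[OF zero_carrier_mat G zero_carrier_mat H] by simp
    qed
    moreover have "A + ?B m + (0\<^sub>m n (sum_list ms) @\<^sub>c block_row n (map ?h [0..<length ns]))
      = A + (?B m + (0\<^sub>m n (sum_list ms) @\<^sub>c block_row n (map ?h [0..<length ns])))"
      by (rule assoc_add_mat) (use A G H in auto)
    ultimately show ?case using Suc by simp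
  qed
  from this[of "length ns"]
  have "foldl (\<lambda>M q. M + Z q * neg_unit_block_row (ms @ ns) (length ms + q)) A [0..<length ns] = A + ?B (length ns)"
    by simp
  also have "map (?g (length ns)) [0..<length ns] = map (\<lambda>q. - Z q) [0..<length ns]"
    by auto
  also have "block_row n \<dots> = - block_row n (map Z [0..<length ns])"
    by (rule block_row_uminus) (use Z in auto)
  finally show ?thesis .
qed

lemma unit_block_pair:
  fixes m n :: nat
  shows "neg_unit_block_row [m, n] 0 = (- 1\<^sub>m m :: 'b::ring_1 mat) @\<^sub>c 0\<^sub>m m n"
    "neg_unit_block_row [m, n] 1 = (0\<^sub>m n m :: 'b mat) @\<^sub>c - 1\<^sub>m n"
    "unit_block_col [m, n] 0 = (1\<^sub>m m :: 'b mat) @\<^sub>r 0\<^sub>m n m"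
    "unit_block_col [m, n] 1 = (0\<^sub>m m n :: 'b mat) @\<^sub>r 1\<^sub>m n"
  by (simp_all add: neg_unit_block_row_def unit_block_col_def upt_conv_Cons)

lemma neg_unit_block_row_pair_mult:
  fixes A B :: "'b::ring_1 mat"
  assumes A: "A \<in> carrier_mat m p" and B: "B \<in> carrier_mat n p"
  shows "neg_unit_block_row [m, n] 0 * (A @\<^sub>r B) = - A"
    "neg_unit_block_row [m, n] 1 * (A @\<^sub>r B) = - B"
proof -
  have "neg_unit_block_row [m, n] 0 * (A @\<^sub>r B) = - 1\<^sub>m m * A + 0\<^sub>m m n * B"
    unfolding unit_block_pair by (rule append_cols_mult_append_rows) (use A B in auto)
  then show "neg_unit_block_row [m, n] 0 * (A @\<^sub>r B) = - A"
    using A B by simp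
  have "neg_unit_block_row [m, n] 1 * (A @\<^sub>r B) = 0\<^sub>m n m * A + - 1\<^sub>m n * B"
    unfolding unit_block_pair by (rule append_cols_mult_append_rows) (use A B in auto)
  then show "neg_unit_block_row [m, n] 1 * (A @\<^sub>r B) = - B"
    using A B by simp
qed

text \<open>The minus sign sits once on the row and once on the column because the two factors play
  different roles: the unit column inserts on the left and needs a left inverse, the negative unit
  row inserts on the right and needs a right inverse.\<close>

lemma unit_block_pair_inverse:
  fixes m n :: nat
  assumes "l < 2"
  shows "- neg_unit_block_row [m, n] l * unit_block_col [m, n] l = (1\<^sub>m ([m, n] ! l) :: 'b::ring_1 mat)"
    "neg_unit_block_row [m, n] l * - unit_block_col [m, n] l = (1\<^sub>m ([m, n] ! l) :: 'b::ring_1 mat)"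
proof -
  let ?R = "neg_unit_block_row [m, n] l :: 'b mat" and ?C = "unit_block_col [m, n] l :: 'b mat"
  have "l = 0 \<or> l = 1" using assms by auto
  then have "?R * ?C = - 1\<^sub>m ([m, n] ! l)"
    using neg_unit_block_row_pair_mult(1)[of "1\<^sub>m m :: 'b mat" m m "0\<^sub>m n m" n]
      neg_unit_block_row_pair_mult(2)[of "0\<^sub>m m n :: 'b mat" m n "1\<^sub>m n" n]
    by (auto simp: unit_block_pair(3) unit_block_pair(4)[unfolded One_nat_def])
  moreover have "dim_col ?R = dim_row ?C"
    using neg_unit_block_row_carrier[of "[m, n]" l, where ?'b = 'b] unit_block_col_carrier[of "[m, n]" l, where ?'b = 'b]
    by simp
  ultimately show "- ?R * ?C = 1\<^sub>m ([m, n] ! l)" "?R * - ?C = 1\<^sub>m ([m, n] ! l)"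
    by (simp_all add: uminus_mult_left_mat uminus_mult_right_mat)
qed

section \<open>The rank of a linearized transfer matrix\<close>

text \<open>The relay terms change only the last \<open>k\<close> columns. In the receiver columns
  the identity from \<open>lin_A\<close> is untouched, and this is where the triangular shape of the
  lower right block comes from.\<close>

lemma four_block_minus_append:
  fixes X :: "'b::ring_1 mat"
  assumes X: "X \<in> carrier_mat r k" and L: "L \<in> carrier_mat k k"
  shows "four_block_mat (0\<^sub>m a a) (0\<^sub>m a (r + k)) (0\<^sub>m (r + k) a) (1\<^sub>m (r + k))
      + (0\<^sub>m (a + (r + k)) (a + r) @\<^sub>c - (0\<^sub>m a k @\<^sub>r X @\<^sub>r L))
    = four_block_mat (0\<^sub>m a a) (0\<^sub>m a (r + k)) (0\<^sub>m (r + k) a)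
        (four_block_mat (1\<^sub>m r) (- X) (0\<^sub>m k r) (1\<^sub>m k - L))"
  using assms by (intro eq_matI) (auto simp: index_append)

text \<open>Here \<open>a\<close>, \<open>r\<close> and \<open>k\<close> are the total auxiliary,
  receiver and relay dimensions; \<open>F1\<close> and \<open>F2\<close> are the channels from the
  transmitter to the receivers and to the relays. \<open>u\<close> and \<open>v\<close> choose an
  auxiliary block, \<open>w\<close> a receiver. The hypothesis \<open>wG\<close> is the only link to
  the transfer matrix \<open>G\<close>.\<close>

lemma mat_rank_linearized:
  fixes X :: "'b::field mat"
  assumes X: "X \<in> carrier_mat r k" and L: "L \<in> carrier_mat k k"
    and R: "R \<in> carrier_mat k k" "(1\<^sub>m k - L) * R = 1\<^sub>m k"
    and F: "F1 \<in> carrier_mat r m" "F2 \<in> carrier_mat k m"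
    and Kt: "Kt \<in> carrier_mat m p" and v: "v \<in> carrier_mat p a" "v' \<in> carrier_mat a p" "v * v' = 1\<^sub>m p"
    and u: "u \<in> carrier_mat a q" "u' \<in> carrier_mat q a" "u' * u = 1\<^sub>m q" and Kr: "Kr \<in> carrier_mat q s"
    and w: "w \<in> carrier_mat s r" and G: "G \<in> carrier_mat s m"
    and wG: "w * (F1 + X * (R * F2)) = - G"
  shows "mat_rank (four_block_mat (0\<^sub>m a a) (0\<^sub>m a (r + k)) (0\<^sub>m (r + k) a) 
        (four_block_mat (1\<^sub>m r) (- X) (0\<^sub>m k r) (1\<^sub>m k - L))
      + (0\<^sub>m a m @\<^sub>r F1 @\<^sub>r F2) * Kt * (v @\<^sub>c 0\<^sub>m p (r + k))
      + (u @\<^sub>r 0\<^sub>m (r + k) q) * Kr * (0\<^sub>m s a @\<^sub>c w @\<^sub>c 0\<^sub>m s k))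
    = r + k + mat_rank (Kr * G * Kt)"
proof -
  define T where "T = four_block_mat (1\<^sub>m r) (- X) (0\<^sub>m k r) (1\<^sub>m k - L)"
  \<comment> \<open>The inverse of the block triangular \<open>T\<close>; its upper right block
    \<open>X * R\<close> describes signals that pass through the relays before reaching a
    receiver.\<close>
  define R' where "R' = four_block_mat (1\<^sub>m r) (X * R) (0\<^sub>m k r) R"
  define F where "F = (F1 @\<^sub>r F2) * Kt * v"
  define E where "E = u * Kr * (w @\<^sub>c 0\<^sub>m s k)"
  have FF: "F1 @\<^sub>r F2 \<in> carrier_mat (r + k) m" using F by auto
  have W: "w @\<^sub>c 0\<^sub>m s k \<in> carrier_mat s (r + k)" using w by auto
  have Kv: "Kt * v \<in> carrier_mat m a" and uK: "u * Kr \<in> carrier_mat a s" using Kt v u Kr by auto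
  have T: "T \<in> carrier_mat (r + k) (r + k)" and R': "R' \<in> carrier_mat (r + k) (r + k)"
    and Fc: "F \<in> carrier_mat (r + k) a" and Ec: "E \<in> carrier_mat a (r + k)"
    unfolding T_def R'_def F_def E_def
    using R L mult_carrier_mat[OF mult_carrier_mat[OF FF Kt] v(1)] mult_carrier_mat[OF uK W] by auto
  have XR: "X * R \<in> carrier_mat r k" and L1: "1\<^sub>m k - L \<in> carrier_mat k k" and mX: "- X \<in> carrier_mat r k"
    using X R L by auto
  have "T * R' = four_block_mat (1\<^sub>m r * 1\<^sub>m r + - X * 0\<^sub>m k r) (1\<^sub>m r * (X * R) + - X * R)
      (0\<^sub>m k r * 1\<^sub>m r + (1\<^sub>m k - L) * 0\<^sub>m k r) (0\<^sub>m k r * (X * R) + (1\<^sub>m k - L) * R)"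
    unfolding T_def R'_def by (rule mult_four_block_mat) (use X R L in auto)
  also have "- X * R = - (X * R)" using X R by simp
  also have "four_block_mat (1\<^sub>m r * 1\<^sub>m r + - X * 0\<^sub>m k r) (1\<^sub>m r * (X * R) + - (X * R))
      (0\<^sub>m k r * 1\<^sub>m r + (1\<^sub>m k - L) * 0\<^sub>m k r) (0\<^sub>m k r * (X * R) + (1\<^sub>m k - L) * R) = 1\<^sub>m (r + k)"
    unfolding R(2) left_mult_one_mat[OF XR] mat_plus_uminus[OF XR] right_mult_zero_mat[OF mX]
      right_mult_zero_mat[OF L1] left_mult_zero_mat[OF XR] by simp
  finally have TR: "T * R' = 1\<^sub>m (r + k)" .
  \<comment> \<open>Direct plus relayed signal at both receivers, stacked. Only this part of
    \<open>R' * F\<close> survives, since the row multiplying it vanishes on the relay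
    coordinates.\<close>
  define P where "P = F1 + X * (R * F2)"
  have P: "P \<in> carrier_mat r m" and RF2: "R * F2 \<in> carrier_mat k m" unfolding P_def using X R F by auto
  have "R' * (F1 @\<^sub>r F2) = (1\<^sub>m r * F1 + X * R * F2) @\<^sub>r (0\<^sub>m k r * F1 + R * F2)"
    unfolding R'_def by (rule four_block_mult_append_rows) (use X R F in auto)
  also have "\<dots> = P @\<^sub>r R * F2"
    using X R F by (simp add: P_def)
  finally have RF: "R' * (F1 @\<^sub>r F2) = P @\<^sub>r R * F2" .
  have PQ: "P @\<^sub>r R * F2 \<in> carrier_mat (r + k) m" using P RF2 by auto
  have Feq: "F = (F1 @\<^sub>r F2) * (Kt * v)" unfolding F_def by (rule assoc_mult_mat[OF FF Kt v(1)])
  have "R' * F = (P @\<^sub>r R * F2) * (Kt * v)"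
    unfolding Feq RF[symmetric] by (rule assoc_mult_mat[OF R' FF Kv, symmetric])
  then have "E * (R' * F) = u * Kr * ((w @\<^sub>c 0\<^sub>m s k) * ((P @\<^sub>r R * F2) * (Kt * v)))"
    unfolding E_def using assoc_mult_mat[OF uK W mult_carrier_mat[OF PQ Kv]] by simp
  also have "(w @\<^sub>c 0\<^sub>m s k) * ((P @\<^sub>r R * F2) * (Kt * v)) = ((w @\<^sub>c 0\<^sub>m s k) * (P @\<^sub>r R * F2)) * (Kt * v)"
    by (rule assoc_mult_mat[OF W PQ Kv, symmetric])
  also have "(w @\<^sub>c 0\<^sub>m s k) * (P @\<^sub>r R * F2) = w * P + 0\<^sub>m s k * (R * F2)"
    by (rule append_cols_mult_append_rows[OF w zero_carrier_mat P RF2])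
  also have "\<dots> = - G"
    unfolding left_mult_zero_mat[OF RF2] wG[folded P_def] using G by simp
  also have "u * Kr * (- G * (Kt * v)) = - (u * (Kr * G * Kt) * v)"
  proof -
    have KG: "Kr * G \<in> carrier_mat q m" using Kr G by auto
    have GKv: "G * (Kt * v) \<in> carrier_mat s a" using G Kv by auto
    have "u * (Kr * G * Kt) * v = u * (Kr * G * Kt * v)"
      by (rule assoc_mult_mat[OF u(1) mult_carrier_mat[OF KG Kt] v(1)])
    also have "Kr * G * Kt * v = Kr * G * (Kt * v)" by (rule assoc_mult_mat[OF KG Kt v(1)])
    also have "\<dots> = Kr * (G * (Kt * v))" by (rule assoc_mult_mat[OF Kr G Kv])
    also have "u * \<dots> = u * Kr * (G * (Kt * v))" by (rule assoc_mult_mat[OF u(1) Kr GKv, symmetric])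
    finally show ?thesis
      using G Kr Kt by (simp del: assoc_mult_mat)
  qed
  finally have ERF: "E * (R' * F) = - (u * (Kr * G * Kt) * v)" .
  have KGK: "Kr * G * Kt \<in> carrier_mat q p" using Kr G Kt by auto
  \<comment> \<open>The minus sign hidden in \<open>w\<close> cancels the one of the Schur
    complement. A sign inside \<open>v\<close> may remain; it is absorbed by the right inverse of
    \<open>v\<close>.\<close>
  have "0\<^sub>m a a - E * (R' * F) = u * (Kr * G * Kt) * v"
  proof -
    have "0\<^sub>m a a - - M = M" if "M \<in> carrier_mat a a" for M :: "'b mat"
      using that by (intro eq_matI) auto
    then show ?thesis unfolding ERF using mult_carrier_mat[OF mult_carrier_mat[OF u(1) KGK] v(1)] .
  qed
  then have "mat_rank (four_block_mat (0\<^sub>m a a) E F T) = r + k + mat_rank (u * (Kr * G * Kt) * v)"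
    using mat_rank_schur_complement[OF zero_carrier_mat Ec Fc T R' TR] by simp
  also have "mat_rank (u * (Kr * G * Kt) * v) = mat_rank (Kr * G * Kt)"
    by (rule mat_rank_sandwich[OF KGK u v])
  \<comment> \<open>The transmitter term meets only auxiliary columns and fills the lower left
    block; the receiver term meets only auxiliary rows and fills the upper right block.\<close>
  also have "four_block_mat (0\<^sub>m a a) E F T = four_block_mat (0\<^sub>m a a) (0\<^sub>m a (r + k)) (0\<^sub>m (r + k) a) T
      + (0\<^sub>m a m @\<^sub>r F1 @\<^sub>r F2) * Kt * (v @\<^sub>c 0\<^sub>m p (r + k))
      + (u @\<^sub>r 0\<^sub>m (r + k) q) * Kr * (0\<^sub>m s a @\<^sub>c w @\<^sub>c 0\<^sub>m s k)"
  proof -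
    have K1: "(0\<^sub>m a m @\<^sub>r F1 @\<^sub>r F2) * Kt = 0\<^sub>m a p @\<^sub>r (F1 @\<^sub>r F2) * Kt"
      using append_rows_mult[OF zero_carrier_mat FF Kt] Kt by simp
    have FK: "(F1 @\<^sub>r F2) * Kt \<in> carrier_mat (r + k) p" using FF Kt by auto
    have 1: "(0\<^sub>m a m @\<^sub>r F1 @\<^sub>r F2) * Kt * (v @\<^sub>c 0\<^sub>m p (r + k))
        = four_block_mat (0\<^sub>m a a) (0\<^sub>m a (r + k)) F (0\<^sub>m (r + k) (r + k))"
      unfolding K1 append_rows_mult_append_cols[OF zero_carrier_mat FK v(1) zero_carrier_mat] F_def[symmetric]
        right_mult_zero_mat[OF FK] left_mult_zero_mat[OF v(1)] by simp
    have K2: "(u @\<^sub>r 0\<^sub>m (r + k) q) * Kr = u * Kr @\<^sub>r 0\<^sub>m (r + k) s"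
      using append_rows_mult[OF u(1) zero_carrier_mat Kr] Kr by simp
    have 2: "(u @\<^sub>r 0\<^sub>m (r + k) q) * Kr * (0\<^sub>m s a @\<^sub>c w @\<^sub>c 0\<^sub>m s k)
        = four_block_mat (0\<^sub>m a a) E (0\<^sub>m (r + k) a) (0\<^sub>m (r + k) (r + k))"
      unfolding K2 append_rows_mult_append_cols[OF uK zero_carrier_mat zero_carrier_mat W] E_def[symmetric]
        right_mult_zero_mat[OF uK] left_mult_zero_mat[OF W] by simp
    show ?thesis
      unfolding 1 2 using Ec Fc T
      by (simp add: add_four_block_mat[where ?nr1.0 = a and ?nc1.0 = a and ?nr2.0 = "r + k" and ?nc2.0 = "r + k"])
  qed
  finally show ?thesis unfolding T_def .
qed

section \<open>The blocks of a concrete network\<close>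

locale linearized_network =
  fixes N :: "'a::field network"
    and K :: "node \<Rightarrow> 'a poly fract mat"
    and a1 a2 :: nat
  assumes network: "lti_network N"
    and K_Tx1: "K Tx1 \<in> carrier_mat (d_in N Tx1) a1"
    and K_Tx2: "K Tx2 \<in> carrier_mat (d_in N Tx2) a2"
    and K_Relay: "\<And>i. 1 \<le> i \<Longrightarrow> i \<le> num_relays N \<Longrightarrow>
           K (Relay i) \<in> carrier_mat (d_in N (Relay i)) (d_out N (Relay i))"
    and K_Rx1: "K Rx1 \<in> carrier_mat a1 (d_out N Rx1)"
    and K_Rx2: "K Rx2 \<in> carrier_mat a2 (d_out N Rx2)"
    and invertible: "invertible_mat (relay_block_mat N
           (\<lambda>j i. if i = j then 1\<^sub>m (d_out N j) - chan N i j * K i else - (chan N i j * K i)))"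
begin

abbreviation relay_dim :: nat where "relay_dim \<equiv> \<Sum>i\<leftarrow>relays N. d_out N i"

abbreviation rx_dim :: nat where "rx_dim \<equiv> d_out N Rx1 + d_out N Rx2"

text \<open>\<open>to_rx\<close>, \<open>loop_inv\<close> and \<open>from_tx\<close> are the three
  factors of the relayed part of \<open>transfer\<close>.\<close>

definition to_rx :: "node \<Rightarrow> 'a poly fract mat" where
  "to_rx rx = block_row (d_out N rx) (map (\<lambda>i. chan N i rx * K i) (relays N))"

definition from_tx :: "node \<Rightarrow> 'a poly fract mat" where
  "from_tx tx = block_col (d_in N tx) (map (\<lambda>j. chan N tx j) (relays N))"

definition loop_inv :: "'a poly fract mat" where
  "loop_inv = the (mat_inverse (1\<^sub>m relay_dim - loop_gain N K))"

text \<open>Zero-based numbering, so that \<open>q\<close> is also the position of the relay among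
  the blocks that follow the first four.\<close>

lemma relays_eq: "relays N = map (\<lambda>q. Relay (Suc q)) [0..<num_relays N]"
  by (rule nth_equalityI) (auto simp: relays_def simp del: upt_Suc)

lemma distinct_relays: "distinct (relays N)"
  by (simp add: relays_eq distinct_map inj_on_def)

lemma relay_gain_carrier: "i \<in> set (relays N) \<Longrightarrow> K i \<in> carrier_mat (d_in N i) (d_out N i)"
  using K_Relay by (auto simp: relays_eq)

lemma chan_carrier:
  "i \<in> {Tx1, Tx2} \<union> set (relays N) \<Longrightarrow> j \<in> set (relays N) \<union> {Rx1, Rx2} \<Longrightarrow>
    chan N i j \<in> carrier_mat (d_out N j) (d_in N i)"
  using network unfolding lti_network_def by blast

lemma chan_gain_carrier:
  "i \<in> set (relays N) \<Longrightarrow> j \<in> set (relays N) \<union> {Rx1, Rx2} \<Longrightarrow>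
    chan N i j * K i \<in> carrier_mat (d_out N j) (d_out N i)"
  using mult_carrier_mat[OF chan_carrier relay_gain_carrier] by blast

lemma to_rx_carrier:
  "rx \<in> {Rx1, Rx2} \<Longrightarrow> to_rx rx \<in> carrier_mat (d_out N rx) relay_dim"
  unfolding to_rx_def by (rule block_row_carrier) (auto intro: chan_gain_carrier)

lemma from_tx_carrier:
  "tx \<in> {Tx1, Tx2} \<Longrightarrow> from_tx tx \<in> carrier_mat relay_dim (d_in N tx)"
  unfolding from_tx_def by (rule block_col_carrier) (auto intro: chan_carrier)

lemma loop_gain_rows_carrier:
  "j \<in> set (relays N) \<Longrightarrow>
    block_row (d_out N j) (map (\<lambda>i. chan N i j * K i) (relays N)) \<in> carrier_mat (d_out N j) relay_dim"
  by (rule block_row_carrier) (auto intro: chan_gain_carrier)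

lemma loop_gain_carrier: "loop_gain N K \<in> carrier_mat relay_dim relay_dim"
  unfolding loop_gain_def relay_block_mat_def
  by (rule block_col_carrier) (rule loop_gain_rows_carrier)

text \<open>Invertibility is assumed for a matrix given by its blocks, while \<open>transfer\<close>
  inverts a difference; this identifies the two.\<close>

lemma relay_block_mat_eq:
  "relay_block_mat N (\<lambda>j i. if i = j then 1\<^sub>m (d_out N j) - chan N i j * K i else - (chan N i j * K i))
    = 1\<^sub>m relay_dim - loop_gain N K"
proof -
  let ?d = "d_out N"
  let ?I = "\<lambda>j i. if i = j then 1\<^sub>m (?d j) else 0\<^sub>m (?d j) (?d i) :: 'a poly fract mat"
  let ?L = "\<lambda>j i. chan N i j * K i"
  have I: "block_row (?d j) (map (?I j) (relays N)) \<in> carrier_mat (?d j) relay_dim" for j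
    by (rule block_row_carrier) auto
  have "1\<^sub>m relay_dim - loop_gain N K
    = block_col relay_dim (map (\<lambda>j. block_row (?d j) (map (?I j) (relays N))) (relays N))
      - block_col relay_dim (map (\<lambda>j. block_row (?d j) (map (?L j) (relays N))) (relays N))"
    unfolding block_identity[OF distinct_relays] by (simp add: loop_gain_def relay_block_mat_def)
  also have "\<dots> = block_col relay_dim (map (\<lambda>j. block_row (?d j) (map (?I j) (relays N))
      - block_row (?d j) (map (?L j) (relays N))) (relays N))"
    by (rule block_col_minus[OF I loop_gain_rows_carrier])
  also have "map (\<lambda>j. block_row (?d j) (map (?I j) (relays N))
      - block_row (?d j) (map (?L j) (relays N))) (relays N)
    = map (\<lambda>j. block_row (?d j) (map (\<lambda>i. if i = j then 1\<^sub>m (?d j) - ?L j i else - ?L j i) (relays N))) (relays N)"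
  proof (rule map_cong[OF refl])
    fix j assume j: "j \<in> set (relays N)"
    have "block_row (?d j) (map (?I j) (relays N)) - block_row (?d j) (map (?L j) (relays N))
      = block_row (?d j) (map (\<lambda>i. ?I j i - ?L j i) (relays N))"
      by (rule block_row_minus[where c = ?d]) (use j in \<open>auto intro: chan_gain_carrier\<close>)
    also have "map (\<lambda>i. ?I j i - ?L j i) (relays N)
      = map (\<lambda>i. if i = j then 1\<^sub>m (?d j) - ?L j i else - ?L j i) (relays N)"
    proof (rule map_cong[OF refl])
      fix i assume i: "i \<in> set (relays N)"
      have "0\<^sub>m (?d j) (?d i) - M = - M" if "M \<in> carrier_mat (?d j) (?d i)" for M :: "'a poly fract mat"
        using that by (intro eq_matI) auto
      from this[OF chan_gain_carrier[OF i]] j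
      show "?I j i - ?L j i = (if i = j then 1\<^sub>m (?d j) - ?L j i else - ?L j i)" by simp
    qed
    finally show "block_row (?d j) (map (?I j) (relays N)) - block_row (?d j) (map (?L j) (relays N))
      = block_row (?d j) (map (\<lambda>i. if i = j then 1\<^sub>m (?d j) - ?L j i else - ?L j i) (relays N))" .
  qed
  finally show ?thesis by (simp add: relay_block_mat_def)
qed

text \<open>\<open>the (mat_inverse _)\<close> is meaningful only once \<open>None\<close> is
  excluded. This is done by exhibiting the matrix as a unit of the matrix ring, the criterion
  attached to \<open>mat_inverse\<close>.\<close>

lemma loop_inv:
  "loop_inv \<in> carrier_mat relay_dim relay_dim"
  "(1\<^sub>m relay_dim - loop_gain N K) * loop_inv = 1\<^sub>m relay_dim"
proof -
  let ?A = "1\<^sub>m relay_dim - loop_gain N K"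
  have A: "?A \<in> carrier_mat relay_dim relay_dim" using loop_gain_carrier by auto
  obtain B where B: "?A * B = 1\<^sub>m (dim_row ?A)" "B * ?A = 1\<^sub>m (dim_row B)"
    using invertible unfolding relay_block_mat_eq invertible_mat_def inverts_mat_def by blast
  \<comment> \<open>\<open>invertible_mat\<close> does not state the dimensions of the inverse; they
    are read off by comparing the numbers of columns in the two identities.\<close>
  have "B \<in> carrier_mat relay_dim relay_dim"
    using arg_cong[OF B(1), of dim_col] arg_cong[OF B(2), of dim_col] A loop_gain_carrier
    by (intro carrier_matI) auto
  then have "?A \<in> Units (ring_mat TYPE('a poly fract) relay_dim ())"
    using A B loop_gain_carrier unfolding Units_def ring_mat_def by auto
  then have "mat_inverse ?A \<noteq> None" using mat_inverse(1)[OF A, where b = "()"] by blast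
  then have "mat_inverse ?A = Some loop_inv" unfolding loop_inv_def by auto
  from mat_inverse(2)[OF A this]
  show "loop_inv \<in> carrier_mat relay_dim relay_dim" "?A * loop_inv = 1\<^sub>m relay_dim" by auto
qed

lemma transfer_eq:
  assumes "tx \<in> {Tx1, Tx2}" "rx \<in> {Rx1, Rx2}"
  shows "transfer N K tx rx = chan N tx rx + to_rx rx * (loop_inv * from_tx tx)"
  using assoc_mult_mat[OF to_rx_carrier[OF assms(2)] loop_inv(1) from_tx_carrier[OF assms(1)]]
  by (simp add: transfer_def to_rx_def loop_inv_def from_tx_def)

lemma transfer_carrier:
  assumes "tx \<in> {Tx1, Tx2}" "rx \<in> {Rx1, Rx2}"
  shows "transfer N K tx rx \<in> carrier_mat (d_out N rx) (d_in N tx)"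
  unfolding transfer_eq[OF assms]
  using chan_carrier[of tx rx] to_rx_carrier[OF assms(2)] loop_inv(1) from_tx_carrier[OF assms(1)] assms
  by auto

text \<open>Regroups the blocks into auxiliary, receiver and relay rows, the three groups on which
  the abstract rank computation works.\<close>

lemma lin_B_chan_eq:
  assumes "i \<in> {Tx1, Tx2} \<union> set (relays N)"
  shows "lin_B N a1 a2 i = 0\<^sub>m (a1 + a2) (d_in N i) @\<^sub>r (chan N i Rx1 @\<^sub>r chan N i Rx2)
    @\<^sub>r block_col (d_in N i) (map (chan N i) (relays N))"
proof -
  have "lin_B N a1 a2 i = lin_B_chan N a1 a2 i"
    using assms by (auto simp: relays_eq)
  then show ?thesis
    using chan_carrier[OF assms, of Rx1] chan_carrier[OF assms, of Rx2]
    by (simp add: lin_B_chan_def append_rows_assoc index_append flip: append_rows_zero)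
qed

lemma lin_A_eq:
  "lin_A N a1 a2 = four_block_mat (0\<^sub>m (a1 + a2) (a1 + a2)) (0\<^sub>m (a1 + a2) (rx_dim + relay_dim))
    (0\<^sub>m (rx_dim + relay_dim) (a1 + a2)) (1\<^sub>m (rx_dim + relay_dim))"
proof -
  have "diag_block_mat (map (\<lambda>i. 1\<^sub>m (d_out N i)) xs) = (1\<^sub>m (\<Sum>i\<leftarrow>xs. d_out N i) :: 'a poly fract mat)" for xs
    by (induction xs) (auto intro!: eq_matI)
  then show ?thesis
    by (intro eq_matI) (auto simp: lin_A_def Let_def)
qed


lemma foldl_relays:
  "foldl (\<lambda>M i. M + lin_B N a1 a2 i * K i * lin_C N a1 a2 i) (lin_A N a1 a2) (relays N)
    = lin_A N a1 a2 + (0\<^sub>m (a1 + a2 + (rx_dim + relay_dim)) (a1 + a2 + rx_dim)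
      @\<^sub>c - (0\<^sub>m (a1 + a2) relay_dim @\<^sub>r (to_rx Rx1 @\<^sub>r to_rx Rx2) @\<^sub>r loop_gain N K))"
proof -
  let ?n = "a1 + a2 + (rx_dim + relay_dim)"
  let ?ms = "[a1, a2, d_out N Rx1, d_out N Rx2]"
  let ?ns = "map (d_out N) (relays N)"
  let ?Z = "\<lambda>i. lin_B N a1 a2 i * K i"
  have len: "length ?ns = num_relays N" by (simp add: relays_eq)
  have Z_eq: "?Z i = 0\<^sub>m (a1 + a2) (d_out N i) @\<^sub>r (chan N i Rx1 * K i @\<^sub>r chan N i Rx2 * K i)
      @\<^sub>r block_col (d_out N i) (map (\<lambda>j. chan N i j * K i) (relays N))" if i: "i \<in> set (relays N)" for i
  proof -
    have H: "chan N i Rx1 \<in> carrier_mat (d_out N Rx1) (d_in N i)" "chan N i Rx2 \<in> carrier_mat (d_out N Rx2) (d_in N i)"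
      "block_col (d_in N i) (map (chan N i) (relays N)) \<in> carrier_mat relay_dim (d_in N i)"
      using i by (auto intro!: chan_carrier block_col_carrier)
    have Ki: "K i \<in> carrier_mat (d_in N i) (d_out N i)" by (rule relay_gain_carrier[OF i])
    have "block_col (d_in N i) (map (chan N i) (relays N)) * K i
        = block_col (d_out N i) (map (\<lambda>j. chan N i j * K i) (relays N))"
      by (rule block_col_mult[OF Ki, where c = "d_out N"]) (use i in \<open>auto intro: chan_carrier\<close>)
    then show ?thesis
      using i Ki append_rows_mult[OF zero_carrier_mat carrier_append_rows[OF carrier_append_rows[OF H(1,2)] H(3)] Ki]
        append_rows_mult[OF carrier_append_rows[OF H(1,2)] H(3) Ki] append_rows_mult[OF H(1,2) Ki]
      by (simp add: lin_B_chan_eq)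
  qed
  have C: "chan N i Rx1 * K i \<in> carrier_mat (d_out N Rx1) (d_out N i)"
      "chan N i Rx2 * K i \<in> carrier_mat (d_out N Rx2) (d_out N i)"
      "block_col (d_out N i) (map (\<lambda>j. chan N i j * K i) (relays N)) \<in> carrier_mat relay_dim (d_out N i)"
    if "i \<in> set (relays N)" for i
    using that by (auto intro!: chan_gain_carrier block_col_carrier)
  have Z: "?Z i \<in> carrier_mat ?n (d_out N i)" if "i \<in> set (relays N)" for i
    unfolding Z_eq[OF that] using C[OF that] by (intro carrier_append_rows) auto
  have "block_row ?n (map ?Z (relays N)) = block_row ?n (map (\<lambda>i. 0\<^sub>m (a1 + a2) (d_out N i)
      @\<^sub>r (chan N i Rx1 * K i @\<^sub>r chan N i Rx2 * K i)
      @\<^sub>r block_col (d_out N i) (map (\<lambda>j. chan N i j * K i) (relays N))) (relays N))"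
    using Z_eq by (intro arg_cong[where f = "block_row ?n"] map_cong) auto
  also have "\<dots> = block_row (a1 + a2) (map (\<lambda>i. 0\<^sub>m (a1 + a2) (d_out N i)) (relays N))
      @\<^sub>r block_row (rx_dim + relay_dim) (map (\<lambda>i. (chan N i Rx1 * K i @\<^sub>r chan N i Rx2 * K i)
      @\<^sub>r block_col (d_out N i) (map (\<lambda>j. chan N i j * K i) (relays N))) (relays N))"
    by (rule block_row_append_rows[where c = "d_out N"])
      (auto intro!: carrier_append_rows C)
  also have "block_row (rx_dim + relay_dim) (map (\<lambda>i. (chan N i Rx1 * K i @\<^sub>r chan N i Rx2 * K i)
      @\<^sub>r block_col (d_out N i) (map (\<lambda>j. chan N i j * K i) (relays N))) (relays N))
    = block_row rx_dim (map (\<lambda>i. chan N i Rx1 * K i @\<^sub>r chan N i Rx2 * K i) (relays N))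
      @\<^sub>r block_row relay_dim (map (\<lambda>i. block_col (d_out N i) (map (\<lambda>j. chan N i j * K i) (relays N))) (relays N))"
    by (rule block_row_append_rows[where c = "d_out N"]) (auto intro!: carrier_append_rows C)
  also have "block_row rx_dim (map (\<lambda>i. chan N i Rx1 * K i @\<^sub>r chan N i Rx2 * K i) (relays N))
      = to_rx Rx1 @\<^sub>r to_rx Rx2"
    unfolding to_rx_def by (rule block_row_append_rows[where c = "d_out N"]) (auto intro!: C)
  also have "block_row relay_dim (map (\<lambda>i. block_col (d_out N i) (map (\<lambda>j. chan N i j * K i) (relays N))) (relays N))
      = loop_gain N K"
    unfolding loop_gain_def relay_block_mat_def
    by (rule block_row_block_col[where F = "\<lambda>j i. chan N i j * K i"]) (auto intro: chan_gain_carrier)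
  also have "block_row (a1 + a2) (map (\<lambda>i. 0\<^sub>m (a1 + a2) (d_out N i)) (relays N)) = 0\<^sub>m (a1 + a2) relay_dim"
    by (rule block_row_zero)
  finally have rows: "block_row ?n (map ?Z (relays N))
    = 0\<^sub>m (a1 + a2) relay_dim @\<^sub>r (to_rx Rx1 @\<^sub>r to_rx Rx2) @\<^sub>r loop_gain N K" .
  have relays: "relays N = map (\<lambda>q. Relay (Suc q)) [0..<length ?ns]"
    unfolding len by (rule relays_eq)
  \<comment> \<open>The relay at position \<open>q\<close> is \<open>Relay (Suc q)\<close>, whose
    block index \<open>3 + Suc q\<close> equals \<open>length ?ms + q\<close>.\<close>
  have "foldl (\<lambda>M i. M + ?Z i * lin_C N a1 a2 i) (lin_A N a1 a2) (relays N)
    = foldl (\<lambda>M q. M + ?Z (Relay (Suc q)) * neg_unit_block_row (?ms @ ?ns) (length ?ms + q))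
      (lin_A N a1 a2) [0..<length ?ns]"
    by (subst relays) (simp add: foldl_map lin_sizes_def numeral_eq_Suc)
  also have "\<dots> = lin_A N a1 a2
      + (0\<^sub>m ?n (sum_list ?ms) @\<^sub>c - block_row ?n (map (\<lambda>q. ?Z (Relay (Suc q))) [0..<length ?ns]))"
  proof (rule foldl_mult_neg_unit_block_row)
    show "lin_A N a1 a2 \<in> carrier_mat ?n (sum_list (?ms @ ?ns))"
      by (auto simp: lin_A_eq)
    fix q assume "q < length ?ns"
    then show "?Z (Relay (Suc q)) \<in> carrier_mat ?n (?ns ! q)"
      using Z[of "Relay (Suc q)"] by (simp add: relays_eq)
  qed
  also have "map (\<lambda>q. ?Z (Relay (Suc q))) [0..<length ?ns] = map ?Z (relays N)"
    by (subst (2) relays) simp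
  finally show ?thesis unfolding rows by (simp add: add.assoc)
qed


lemma mat_rank_lin_transfer:
  assumes tx: "tx \<in> {Tx1, Tx2}" and rx: "rx \<in> {Rx1, Rx2}"
  shows "mat_rank (lin_transfer N a1 a2 K tx rx)
    = rx_dim + relay_dim + mat_rank (K rx * transfer N K tx rx * K tx)"
proof -
  let ?rest = "[d_out N Rx1, d_out N Rx2] @ map (d_out N) (relays N)"
  \<comment> \<open>Zero-based pair numbers: \<open>l\<close> gives the auxiliary column block of
    the transmitter, and \<open>k\<close> gives both the auxiliary row block and the receiver block
    of the receiver. For the cross pairs \<open>l\<close> and \<open>k\<close> differ, so the
    inserted block lies off the diagonal.\<close>
  define l :: nat where "l = (if tx = Tx1 then 0 else 1)"
  define k :: nat where "k = (if rx = Rx1 then 0 else 1)"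
  have lk: "l < 2" "k < 2" by (auto simp: l_def k_def)
  let ?v = "neg_unit_block_row [a1, a2] l :: 'a poly fract mat"
  let ?v' = "- unit_block_col [a1, a2] l :: 'a poly fract mat"
  let ?u = "unit_block_col [a1, a2] k :: 'a poly fract mat"
  let ?u' = "- neg_unit_block_row [a1, a2] k :: 'a poly fract mat"
  let ?w = "neg_unit_block_row [d_out N Rx1, d_out N Rx2] k :: 'a poly fract mat"
  let ?p = "[a1, a2] ! l" and ?q = "[a1, a2] ! k"
  have wk: "[d_out N Rx1, d_out N Rx2] ! k = d_out N rx" using rx by (auto simp: k_def)
  have sizes: "lin_sizes N a1 a2 = [a1, a2] @ ?rest" by (simp add: lin_sizes_def)
  have "lin_C N a1 a2 tx = neg_unit_block_row (lin_sizes N a1 a2) l"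
    using tx by (auto simp: l_def)
  then have C_tx: "lin_C N a1 a2 tx = ?v @\<^sub>c 0\<^sub>m ?p (rx_dim + relay_dim)"
    unfolding sizes using neg_unit_block_row_append1[of l "[a1, a2]" ?rest] lk by (simp add: add.assoc)
  have "lin_B N a1 a2 rx = unit_block_col (lin_sizes N a1 a2) k"
    using rx by (auto simp: k_def)
  then have B_rx: "lin_B N a1 a2 rx = ?u @\<^sub>r 0\<^sub>m (rx_dim + relay_dim) ?q"
    unfolding sizes using unit_block_col_append[of k "[a1, a2]" ?rest] lk by (simp add: add.assoc)
  have "lin_C N a1 a2 rx = neg_unit_block_row (lin_sizes N a1 a2) (length [a1, a2] + k)"
    using rx by (auto simp: k_def numeral_eq_Suc)
  also have "\<dots> = 0\<^sub>m (?rest ! k) (sum_list [a1, a2]) @\<^sub>c neg_unit_block_row ?rest k"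
    unfolding sizes by (rule neg_unit_block_row_append2)
  also have "neg_unit_block_row ?rest k = ?w @\<^sub>c 0\<^sub>m (d_out N rx) relay_dim"
    using neg_unit_block_row_append1[of k "[d_out N Rx1, d_out N Rx2]" "map (d_out N) (relays N)"] lk wk by simp
  also have "?rest ! k = d_out N rx" using rx by (auto simp: k_def)
  finally have C_rx: "lin_C N a1 a2 rx = 0\<^sub>m (d_out N rx) (a1 + a2) @\<^sub>c ?w @\<^sub>c 0\<^sub>m (d_out N rx) relay_dim"
    by simp
  have F: "chan N tx Rx1 \<in> carrier_mat (d_out N Rx1) (d_in N tx)" "chan N tx Rx2 \<in> carrier_mat (d_out N Rx2) (d_in N tx)"
    using tx by (auto intro: chan_carrier)
  have X: "to_rx Rx1 \<in> carrier_mat (d_out N Rx1) relay_dim" "to_rx Rx2 \<in> carrier_mat (d_out N Rx2) relay_dim"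
    by (auto intro: to_rx_carrier)
  have B_tx: "lin_B N a1 a2 tx = 0\<^sub>m (a1 + a2) (d_in N tx) @\<^sub>r (chan N tx Rx1 @\<^sub>r chan N tx Rx2) @\<^sub>r from_tx tx"
    using lin_B_chan_eq[of tx] tx by (auto simp: from_tx_def)
  have G: "transfer N K tx Rx1 \<in> carrier_mat (d_out N Rx1) (d_in N tx)"
      "transfer N K tx Rx2 \<in> carrier_mat (d_out N Rx2) (d_in N tx)"
    using transfer_carrier[OF tx] by auto
  have RF: "loop_inv * from_tx tx \<in> carrier_mat relay_dim (d_in N tx)"
    using loop_inv(1) from_tx_carrier[OF tx] by auto
  \<comment> \<open>The stacked signal is the pair of transfer matrices from \<open>tx\<close> to
    both receivers; \<open>?w\<close> then picks the one for \<open>rx\<close> with a minus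
    sign.\<close>
  have "(chan N tx Rx1 @\<^sub>r chan N tx Rx2) + (to_rx Rx1 @\<^sub>r to_rx Rx2) * (loop_inv * from_tx tx)
    = transfer N K tx Rx1 @\<^sub>r transfer N K tx Rx2"
    unfolding append_rows_mult[OF X RF]
      append_rows_add[OF F mult_carrier_mat[OF X(1) RF] mult_carrier_mat[OF X(2) RF]]
    by (simp add: transfer_eq[OF tx])
  moreover have "?w * (transfer N K tx Rx1 @\<^sub>r transfer N K tx Rx2) = - transfer N K tx rx"
  proof (cases "rx = Rx1")
    case True
    then show ?thesis using neg_unit_block_row_pair_mult(1)[OF G] by (simp add: k_def)
  next
    case False
    with rx have "rx = Rx2" by simp
    then show ?thesis using neg_unit_block_row_pair_mult(2)[OF G] by (simp add: k_def)
  qed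
  ultimately have wG: "?w * ((chan N tx Rx1 @\<^sub>r chan N tx Rx2)
      + (to_rx Rx1 @\<^sub>r to_rx Rx2) * (loop_inv * from_tx tx)) = - transfer N K tx rx"
    by simp
  have u: "?u \<in> carrier_mat (a1 + a2) ?q" "?u' \<in> carrier_mat ?q (a1 + a2)"
    and v: "?v \<in> carrier_mat ?p (a1 + a2)" "?v' \<in> carrier_mat (a1 + a2) ?p"
    using unit_block_col_carrier[of "[a1, a2]" k, where ?'b = "'a poly fract"]
      unit_block_col_carrier[of "[a1, a2]" l, where ?'b = "'a poly fract"]
      neg_unit_block_row_carrier[of "[a1, a2]" k, where ?'b = "'a poly fract"]
      neg_unit_block_row_carrier[of "[a1, a2]" l, where ?'b = "'a poly fract"]
    by simp_all
  have w: "?w \<in> carrier_mat (d_out N rx) rx_dim"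
    using neg_unit_block_row_carrier[of "[d_out N Rx1, d_out N Rx2]" k] unfolding wk by simp
  have Kt: "K tx \<in> carrier_mat (d_in N tx) ?p" and Kr: "K rx \<in> carrier_mat ?q (d_out N rx)"
    using tx rx K_Tx1 K_Tx2 K_Rx1 K_Rx2 by (auto simp: l_def k_def)
  have fold: "foldl (\<lambda>M i. M + lin_B N a1 a2 i * K i * lin_C N a1 a2 i) (lin_A N a1 a2) (relays N)
    = four_block_mat (0\<^sub>m (a1 + a2) (a1 + a2)) (0\<^sub>m (a1 + a2) (rx_dim + relay_dim)) (0\<^sub>m (rx_dim + relay_dim) (a1 + a2))
        (four_block_mat (1\<^sub>m rx_dim) (- (to_rx Rx1 @\<^sub>r to_rx Rx2)) (0\<^sub>m relay_dim rx_dim) (1\<^sub>m relay_dim - loop_gain N K))"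
    unfolding foldl_relays unfolding lin_A_eq
    by (rule four_block_minus_append[OF carrier_append_rows[OF X] loop_gain_carrier])
  show ?thesis
    unfolding lin_transfer_def fold B_tx C_tx B_rx C_rx
    by (rule mat_rank_linearized[OF carrier_append_rows[OF X] loop_gain_carrier loop_inv
      carrier_append_rows[OF F] from_tx_carrier[OF tx] Kt v unit_block_pair_inverse(2)[OF lk(1)]
      u unit_block_pair_inverse(1)[OF lk(2)] Kr w transfer_carrier[OF tx rx] wG])
qed

end

theorem theorem15:
  fixes N :: "'a::field network"
    and K :: "node \<Rightarrow> 'a poly fract mat"
    and dax1 dax2 d d1 d2 d3 d4 :: nat
  assumes "lti_network N"
    and "dax1 > 0" and "dax2 > 0"
    and "K Tx1 \<in> carrier_mat (d_in N Tx1) dax1"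
    and "K Tx2 \<in> carrier_mat (d_in N Tx2) dax2"
    and "\<And>i. 1 \<le> i \<Longrightarrow> i \<le> num_relays N \<Longrightarrow>
           K (Relay i) \<in> carrier_mat (d_in N (Relay i)) (d_out N (Relay i))"
    and "K Rx1 \<in> carrier_mat dax1 (d_out N Rx1)"
    and "K Rx2 \<in> carrier_mat dax2 (d_out N Rx2)"
    and "invertible_mat (relay_block_mat N
           (\<lambda>j i. if i = j then 1\<^sub>m (d_out N j) - chan N i j * K i else - (chan N i j * K i)))"
    and "d = d_out N Rx1 + d_out N Rx2 + (\<Sum>i = 1..num_relays N. d_out N (Relay i))"
  shows
    "(mat_rank (K Rx1 * transfer N K Tx1 Rx1 * K Tx1) \<ge> d1 \<and>
      mat_rank (K Rx2 * transfer N K Tx2 Rx2 * K Tx2) \<ge> d2 \<and>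
      mat_rank (K Rx2 * transfer N K Tx1 Rx2 * K Tx1) \<le> d3 \<and>
      mat_rank (K Rx1 * transfer N K Tx2 Rx1 * K Tx2) \<le> d4)
     \<longleftrightarrow>
     (mat_rank (lin_transfer N dax1 dax2 K Tx1 Rx1) \<ge> d + d1 \<and>
      mat_rank (lin_transfer N dax1 dax2 K Tx2 Rx2) \<ge> d + d2 \<and>
      mat_rank (lin_transfer N dax1 dax2 K Tx1 Rx2) \<le> d + d3 \<and>
      mat_rank (lin_transfer N dax1 dax2 K Tx2 Rx1) \<le> d + d4)"
proof -
  interpret linearized_network N K dax1 dax2
    by unfold_locales (use assms in auto)
  have "relay_dim = (\<Sum>i = 1..num_relays N. d_out N (Relay i))"
    by (simp add: relays_def comp_def atLeastLessThanSuc_atLeastAtMost flip: sum_set_upt_conv_sum_list_nat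
      del: upt_Suc)
  then have "rx_dim + relay_dim = d" using assms by simp
  then show ?thesis by (simp add: mat_rank_lin_transfer)
qed

end
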